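(* Let $d\ge1$ be an integer. Given real numbers $0<a<b<c<1$, there exists a compact set $E\subset\mathbb{R}^d$ such that $\underline{\dim}_{\rm MB}E=a$, $\overline{\dim}_{\rm C}E=b$ and $\dim_{\rm P}E=c$.
   Context: $B(x,r)$ is the closed Euclidean ball with centre $x$ and radius $r$, and $|A|$ is the diameter of a set $A$. $\mathcal{P}(E)$ is the set of Borel probability measures on $\mathbb{R}^d$ supported by $E$, i.e. with $\mu(\mathbb{R}^d\setminus E)=0$. Modified lower box dimension: for non-empty bounded $A\subset\mathbb{R}^d$ and $r>0$, $N_r(A)$ is the least number of sets of diameter $r$ that can cover $A$, and $\underline{\dim}_{\rm B}A=\liminf_{r\to0}\frac{\log N_r(A)}{-\log r}$. Then $\underline{\dim}_{\rm MB}E=\inf\{\sup_i\underline{\dim}_{\rm B}E_i:\ E\subset\bigcup_{i=1}^\infty E_i,\ E_i\text{ (non-empty) compact}\}$. Upper correlation dimension: for a Borel probability measure $\mu$, $\overline{\dim}_{\rm C}\mu=\limsup_{r\to0}\frac{\log\int\mu(B(x,r))\,d\mu(x)}{\log r}$, and for a Borel set $E$, $\overline{\dim}_{\rm C}E=\sup_{\mu\in\mathcal{P}(E)}\overline{\dim}_{\rm C}\mu$. Packing dimension: a $\delta$-packing of $E$ is a finite or countable family of disjoint closed balls of radii at most $\delta$ with centres in $E$. For $s\ge0$, let $\mathcal{P}^s_\delta(E)=\sup\{\sum_i|B_i|^s:\{B_i\}\text{ a }\delta\text{-packing of }E\}$, $\mathcal{P}^s_0(E)=\inf_{\delta>0}\mathcal{P}^s_\delta(E)$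 and $\mathcal{P}^s(E)=\inf\{\sum_{i=1}^\infty\mathcal{P}^s_0(E_i):E\subset\bigcup_{i=1}^\infty E_i\}$. Then $\dim_{\rm P}E=\inf\{s\ge0:\mathcal{P}^s(E)=0\}$. *)

theory Defs
  imports "HOL-Analysis.Analysis" "HOL-Probability.Probability"
begin

text \<open>
  All dimensions take values in \<^typ>\<open>ereal\<close>, so that suprema, infima and upper and lower limits
  always exist.
\<close>

text \<open>
  The library's \<^const>\<open>diameter\<close> is a real number and has no meaning on unbounded sets, hence the
  explicit boundedness condition. For bounded \<open>A\<close> and \<open>r > 0\<close> such a finite cover exists,
  so \<open>LEAST\<close> is meaningful.
\<close>

definition covering_number :: "real \<Rightarrow> 'a::euclidean_space set \<Rightarrow> nat" where
  "covering_number r A =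
     (LEAST n. \<exists>\<C>. finite \<C> \<and> card \<C> = n \<and> (\<forall>U\<in>\<C>. bounded U \<and> diameter U = r) \<and> A \<subseteq> \<Union>\<C>)"

definition lower_box_dim :: "'a::euclidean_space set \<Rightarrow> ereal" where
  "lower_box_dim A = Liminf (at_right 0) (\<lambda>r. ereal (ln (real (covering_number r A)) / - ln r))"

definition modified_lower_box_dim :: "'a::euclidean_space set \<Rightarrow> ereal" where
  "modified_lower_box_dim E =
     (INF F \<in> {F :: nat \<Rightarrow> 'a set. (\<forall>i. F i \<noteq> {} \<and> compact (F i)) \<and> E \<subseteq> (\<Union>i. F i)}.
        SUP i. lower_box_dim (F i))"

definition borel_prob_measures_on :: "'a::euclidean_space set \<Rightarrow> 'a measure set" where
  "borel_prob_measures_on E = {\<mu>. prob_space \<mu> \<and> sets \<mu> = sets borel \<and> emeasure \<mu> (UNIV - E) = 0}"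

text \<open>
  For a Borel probability measure the integrand is a Borel function with values in \<open>[0, 1]\<close>
  (it is upper semicontinuous) and the integral is positive for every \<open>r > 0\<close>, so neither the
  Bochner integral nor the logarithm takes a default value.
\<close>

definition upper_correlation_dim_measure :: "'a::euclidean_space measure \<Rightarrow> ereal" where
  "upper_correlation_dim_measure \<mu> =
     Limsup (at_right 0) (\<lambda>r. ereal (ln (LINT x|\<mu>. measure \<mu> (cball x r)) / ln r))"

definition upper_correlation_dim :: "'a::euclidean_space set \<Rightarrow> ereal" where
  "upper_correlation_dim E = (SUP \<mu> \<in> borel_prob_measures_on E. upper_correlation_dim_measure \<mu>)"

text \<open>
  Radii are positive, so the balls are non-empty; a disjoint family of them has no repetitions and
  may be identified with the set of its members.
\<close>

definition is_packing :: "real \<Rightarrow> 'a::euclidean_space set \<Rightarrow> 'a set set \<Rightarrow> bool" where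
  "is_packing \<delta> E \<B> \<longleftrightarrow>
     countable \<B> \<and> disjoint \<B> \<and> (\<forall>B\<in>\<B>. \<exists>x\<in>E. \<exists>\<rho>. 0 < \<rho> \<and> \<rho> \<le> \<delta> \<and> B = cball x \<rho>)"

definition packing_sup :: "real \<Rightarrow> real \<Rightarrow> 'a::euclidean_space set \<Rightarrow> ennreal" where
  "packing_sup s \<delta> E = (SUP \<B> \<in> {\<B>. is_packing \<delta> E \<B>}. \<Sum>\<^sub>\<infinity>B\<in>\<B>. ennreal (diameter B powr s))"

definition packing_premeasure :: "real \<Rightarrow> 'a::euclidean_space set \<Rightarrow> ennreal" where
  "packing_premeasure s E = (INF \<delta> \<in> {0<..}. packing_sup s \<delta> E)"

definition packing_measure :: "real \<Rightarrow> 'a::euclidean_space set \<Rightarrow> ennreal" where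
  "packing_measure s E =
     (INF F \<in> {F :: nat \<Rightarrow> 'a set. E \<subseteq> (\<Union>i. F i)}. \<Sum>i. packing_premeasure s (F i))"

definition packing_dim :: "'a::euclidean_space set \<Rightarrow> ereal" where
  "packing_dim E = (INF s \<in> {s. 0 \<le> s \<and> packing_measure s E = 0}. ereal s)"

end

theory Submission
  imports Defs
begin

text \<open>
  The set lies on a line and is a union of three compact pieces with dimensions
  \<open>(a, a, a)\<close>, \<open>(0, b, b)\<close> and \<open>(0, 0, c)\<close>, in the order modified lower box, upper correlation,
  packing. Each of the three dimensions of the union is the largest one among the pieces.

  All pieces live in one self-similar Cantor set of dimension \<open>c\<close>, whose points are
  \<open>\<Sum>n. \<omega> n * \<rho> ^ n\<close> for 0-1 sequences \<open>\<omega>\<close>, where \<open>\<rho> = 2 powr (- 1 / c) < 1 / 2\<close>. Two points have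
  distance of order \<open>\<rho> ^ n\<close> if and only if \<open>n\<close> is the first position at which their sequences differ
  (\<open>dist_point_le\<close>, \<open>dist_point_ge\<close>). So a set of sequences has to be designed, and dimension becomes
  counting of prefixes: \<open>2 ^ m\<close> prefixes of length \<open>n\<close> mean dimension \<open>c * m / n\<close> at scale \<open>\<rho> ^ n\<close>.

  For the first two pieces the sequences are free on a set \<open>D\<close> of positions and zero elsewhere. The
  image of the coin-tossing measure under this coding distributes its mass evenly at every scale, so
  that the lower and upper densities of \<open>D\<close> give the two dimensions. For the first piece \<open>D\<close> has
  density \<open>a / c\<close>. For the second, \<open>D\<close> has density \<open>b / c\<close> within blocks \<open>[(2k)!, (2k+1)!)\<close> and is empty
  outside; as \<open>m! / (m+1)!\<close> tends to zero, the upper density is \<open>b / c\<close> and the lower density is zero.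

  The third piece separates packing dimension from correlation dimension. In block \<open>k\<close> a sequence
  is free only if its first \<open>(2k)!\<close> digits are a prescribed target \<open>u k\<close>, and every finite
  prefix is a target infinitely often. So every relatively open part has, at some arbitrarily small
  scales, nearly the covering number of the full Cantor set, and by Baire's theorem the packing
  dimension is \<open>c\<close> (\<open>packing_dim_ge\<close>). But at any given scale only the part near one target is
  large, and that part shrinks to a point as \<open>k\<close> grows. A measure without atoms therefore has half of
  its mass on a part which needs very few balls, and an atom makes the correlation integral bounded
  below; in both cases the correlation dimension is zero (\<open>correlation_dim_targeted_le\<close>).
\<close>

section \<open>Covering numbers and correlation integrals\<close>

text \<open>
  Upper bounds on covering numbers and lower bounds on correlation integrals both start from a
  cover by equal balls. Unlike the sets of diameter exactly \<open>r\<close> in \<^const>\<open>covering_number\<close>, balls are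
  measurable, and their number and radius can be increased freely.
\<close>

definition covered_by_balls :: "nat \<Rightarrow> real \<Rightarrow> 'a::metric_space set \<Rightarrow> bool" where
  "covered_by_balls N r A \<longleftrightarrow> (\<exists>X. finite X \<and> card X \<le> N \<and> A \<subseteq> (\<Union>x\<in>X. cball x r))"

lemma covering_number_witness:
  fixes A :: "'a::euclidean_space set"
  assumes "covered_by_balls N (r / 2) A" "0 < r"
  shows "covering_number r A \<le> N"
    and "\<exists>\<C>. finite \<C> \<and> card \<C> = covering_number r A \<and> (\<forall>U\<in>\<C>. bounded U \<and> diameter U = r) \<and> A \<subseteq> \<Union>\<C>"
proof -
  let ?P = "\<lambda>n. \<exists>\<C>. finite \<C> \<and> card \<C> = n \<and> (\<forall>U\<in>\<C>. bounded U \<and> diameter U = r) \<and> A \<subseteq> \<Union>\<C>"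
  obtain X where X: "finite X" "card X \<le> N" "A \<subseteq> (\<Union>x\<in>X. cball x (r/2))"
    using assms(1) unfolding covered_by_balls_def by blast
  let ?C = "(\<lambda>x. cball x (r/2)) ` X"
  have P: "?P (card ?C)"
    using X assms(2) by (intro exI[of _ ?C]) auto
  have "card ?C \<le> N"
    using X card_image_le le_trans by blast
  moreover have "covering_number r A \<le> card ?C"
    unfolding covering_number_def by (rule Least_le) (rule P)
  ultimately show "covering_number r A \<le> N" by simp
  show "?P (covering_number r A)"
    unfolding covering_number_def by (rule LeastI[of ?P]) (rule P)
qed

lemma compact_imp_covered_by_balls:
  fixes A :: "'a::metric_space set"
  assumes "compact A" "0 < r"
  shows "\<exists>N. covered_by_balls N r A"
proof -
  obtain X where "finite X" "A \<subseteq> (\<Union>x\<in>X. ball x r)"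
    using assms compact_eq_totally_bounded[of A] by meson
  moreover have "(\<Union>x\<in>X. ball x r) \<subseteq> (\<Union>x\<in>X. cball x r)"
    by (intro UN_mono ball_subset_cball order_refl)
  ultimately show ?thesis
    unfolding covered_by_balls_def
    by (intro exI[of _ "card X"] exI[of _ X] conjI order_refl) (assumption, rule order_trans)
qed

lemma covered_by_balls_mono:
  "covered_by_balls N r A \<Longrightarrow> B \<subseteq> A \<Longrightarrow> N \<le> M \<Longrightarrow> r \<le> s \<Longrightarrow> covered_by_balls M s B"
  unfolding covered_by_balls_def
  by (meson UN_mono order.trans order_refl subset_cball)

lemma borel_measurable_measure_cball:
  fixes \<mu> :: "'a::euclidean_space measure"
  assumes "prob_space \<mu>" "sets \<mu> = sets borel"
  shows "(\<lambda>x. measure \<mu> (cball x r)) \<in> borel_measurable \<mu>"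
proof -
  interpret prob_space \<mu> by fact
  let ?Q = "{p :: 'a \<times> 'a. dist (fst p) (snd p) \<le> r}"
  have "closed ?Q" by (intro closed_Collect_le continuous_intros)
  then have "?Q \<in> sets (borel \<Otimes>\<^sub>M borel)" unfolding borel_prod by (rule borel_closed)
  also have "sets (borel \<Otimes>\<^sub>M borel) = sets (\<mu> \<Otimes>\<^sub>M \<mu>)"
    using assms(2) by (intro sets_pair_measure_cong) auto
  finally have "(\<lambda>x. emeasure \<mu> (Pair x -` ?Q)) \<in> borel_measurable \<mu>"
    by (rule measurable_emeasure_Pair)
  moreover have "Pair x -` ?Q = cball x r" for x by auto
  ultimately show ?thesis unfolding measure_def by simp
qed

text \<open>
  If \<open>N\<close> balls of radius \<open>r / 2\<close> cover \<open>A\<close>, then those of them with less than \<open>1 / (2 N)\<close> of the mass of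
  \<open>A\<close> carry together at most half of this mass. Every point in one of the other balls has that whole
  ball within distance \<open>r\<close>.
\<close>

lemma correlation_integral_ge:
  fixes \<mu> :: "'a::euclidean_space measure"
  assumes \<mu>: "prob_space \<mu>" "sets \<mu> = sets borel"
    and A: "A \<in> sets borel" "covered_by_balls N (r / 2) A"
  shows "(measure \<mu> A)\<^sup>2 / (4 * real N) \<le> (LINT x|\<mu>. measure \<mu> (cball x r))"
proof (cases "N = 0")
  case True
  then show ?thesis by simp
next
  case False
  interpret prob_space \<mu> by fact
  note [measurable] = borel_measurable_measure_cball[OF \<mu>]
  have sp: "space \<mu> = UNIV" using sets_eq_imp_space_eq[OF \<mu>(2)] by simp
  define t where "t = measure \<mu> A / (2 * real N)"
  define G where "G = {x \<in> space \<mu>. t \<le> measure \<mu> (cball x r)}"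
  have G: "G \<in> sets \<mu>" unfolding G_def by measurable
  have A': "A \<in> sets \<mu>" using A \<mu> by simp
  have t0: "0 \<le> t" unfolding t_def by simp
  obtain X where X: "finite X" "card X \<le> N" "A \<subseteq> (\<Union>x\<in>X. cball x (r/2))"
    using A(2) unfolding covered_by_balls_def by blast
  define X' where "X' = {x\<in>X. measure \<mu> (cball x (r/2)) \<le> t}"
  have cb: "cball x s \<in> sets \<mu>" for x s using \<mu> by simp
  have sub: "A - G \<subseteq> (\<Union>x\<in>X'. cball x (r/2))"
  proof
    fix y assume y: "y \<in> A - G"
    then obtain x where x: "x \<in> X" "y \<in> cball x (r/2)" using X by auto
    have "cball x (r/2) \<subseteq> cball y r"
    proof
      fix z assume "z \<in> cball x (r/2)"
      then show "z \<in> cball y r"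
        using x dist_triangle[of y z x] by (auto simp: dist_commute)
    qed
    then have "measure \<mu> (cball x (r/2)) \<le> measure \<mu> (cball y r)"
      by (intro finite_measure_mono cb)
    also have "\<dots> < t" using y by (auto simp: G_def sp not_le)
    finally show "y \<in> (\<Union>x\<in>X'. cball x (r/2))" using x by (auto simp: X'_def intro!: bexI[of _ x])
  qed
  have finX': "finite X'" "card X' \<le> N"
    using X card_mono[of X X'] by (auto simp: X'_def)
  have "measure \<mu> (A - G) \<le> measure \<mu> (\<Union>x\<in>X'. cball x (r/2))"
    using finX' cb by (intro finite_measure_mono sub) auto
  also have "\<dots> \<le> (\<Sum>x\<in>X'. measure \<mu> (cball x (r/2)))"
    using finX' cb by (intro finite_measure_subadditive_finite) auto
  also have "\<dots> \<le> real (card X') * t"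
    by (rule sum_bounded_above) (auto simp: X'_def)
  also have "\<dots> \<le> real N * t" using finX' t0 by (intro mult_right_mono) auto
  also have "\<dots> = measure \<mu> A / 2" using False by (simp add: t_def)
  finally have 1: "measure \<mu> (A - G) \<le> measure \<mu> A / 2" .
  have "measure \<mu> A \<le> measure \<mu> ((A - G) \<union> G)"
    using A' G by (intro finite_measure_mono) auto
  also have "\<dots> \<le> measure \<mu> (A - G) + measure \<mu> G"
    using A' G by (intro measure_Un_le) auto
  finally have 2: "measure \<mu> A / 2 \<le> measure \<mu> G" using 1 by simp
  have "(measure \<mu> A)\<^sup>2 / (4 * real N) = t * (measure \<mu> A / 2)"
    by (simp add: t_def power2_eq_square)
  also have "\<dots> \<le> t * measure \<mu> G" using 2 t0 by (rule mult_left_mono)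
  also have "\<dots> = (LINT x|\<mu>. t * indicator G x)"
    using G by simp
  also have "\<dots> \<le> (LINT x|\<mu>. measure \<mu> (cball x r))"
  proof (rule integral_mono)
    show "integrable \<mu> (\<lambda>x. t * indicator G x)"
      using G by (intro integrable_mult_right integrable_real_indicator) (auto simp: less_top[symmetric])
    show "integrable \<mu> (\<lambda>x. measure \<mu> (cball x r))"
      by (rule integrable_const_bound[where B=1]) auto
    show "t * indicator G x \<le> measure \<mu> (cball x r)" if "x \<in> space \<mu>" for x
      using that by (auto simp: G_def indicator_def)
  qed
  finally show ?thesis .
qed

text \<open>
  A lower limit over \<open>r \<rightarrow> 0\<close> is bounded above by the limit along any sequence of scales, and
  an upper limit is bounded below by it.
\<close>

lemma Liminf_le_lim_along:
  fixes f :: "real \<Rightarrow> real"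
  assumes "filterlim r F sequentially" "eventually (\<lambda>k. f (r k) \<le> h k) sequentially" "h \<longlonglongrightarrow> l"
  shows "Liminf F (\<lambda>x. ereal (f x)) \<le> ereal l"
proof -
  have "Liminf F (\<lambda>x. ereal (f x)) \<le> Liminf (filtermap r sequentially) (\<lambda>x. ereal (f x))"
    using assms(1) unfolding filterlim_def Liminf_def
    by (intro SUP_subset_mono) (auto dest: filter_leD)
  also have "\<dots> \<le> Liminf sequentially (\<lambda>k. ereal (f (r k)))" by (rule Liminf_filtermap_le)
  also have "\<dots> \<le> Liminf sequentially (\<lambda>k. ereal (h k))"
    using assms(2) by (intro Liminf_mono) (auto elim!: eventually_mono)
  also have "\<dots> = ereal l" using assms(3) by (intro lim_imp_Liminf) auto
  finally show ?thesis .
qed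

lemma Limsup_ge_lim_along:
  fixes f :: "real \<Rightarrow> real"
  assumes "filterlim r F sequentially" "eventually (\<lambda>k. h k \<le> f (r k)) sequentially" "h \<longlonglongrightarrow> l"
  shows "ereal l \<le> Limsup F (\<lambda>x. ereal (f x))"
proof -
  have "ereal l = Limsup sequentially (\<lambda>k. ereal (h k))"
    using assms(3) by (intro lim_imp_Limsup[symmetric]) auto
  also have "\<dots> \<le> Limsup sequentially (\<lambda>k. ereal (f (r k)))"
    using assms(2) by (intro Limsup_mono) (auto elim!: eventually_mono)
  also have "\<dots> \<le> Limsup (filtermap r sequentially) (\<lambda>x. ereal (f x))"
    by (rule Limsup_filtermap_ge)
  also have "\<dots> \<le> Limsup F (\<lambda>x. ereal (f x))"
    using assms(1) unfolding filterlim_def Limsup_def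
    by (intro INF_superset_mono) (auto dest: filter_leD)
  finally show ?thesis .
qed

section \<open>Coding a self-similar Cantor set by binary sequences\<close>

lemma tendsto_divide_minus_ln: "((\<lambda>r. x / - ln r) \<longlongrightarrow> (0::real)) (at_right 0)"
proof (rule tendsto_divide_0[OF tendsto_const filterlim_at_top_imp_at_infinity])
  show "filterlim (\<lambda>r::real. - ln r) at_top (at_right 0)"
    using ln_at_0 by (subst filterlim_uminus_at_top) simp
qed

definition agree :: "nat \<Rightarrow> (nat \<Rightarrow> bool) \<Rightarrow> (nat \<Rightarrow> bool) \<Rightarrow> bool" where
  "agree n \<omega> \<omega>' \<longleftrightarrow> (\<forall>i<n. \<omega> i = \<omega>' i)"

lemma agree_refl [simp]: "agree n \<omega> \<omega>" by (simp add: agree_def)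

lemma open_agree: "open {\<omega>'. agree n \<omega> \<omega>'}"
proof -
  have "open {\<omega>'::nat\<Rightarrow>bool. \<omega> i = \<omega>' i}" for i
  proof -
    have "open (- {\<not> \<omega> i})" by (intro open_Compl closed_singleton)
    also have "- {\<not> \<omega> i} = {\<omega> i}" by auto
    finally have "open ((\<lambda>\<omega>'::nat\<Rightarrow>bool. \<omega>' i) -` {\<omega> i})"
      by (rule open_vimage) simp
    then show ?thesis by (simp add: vimage_def eq_commute)
  qed
  then have "open (\<Inter>i\<in>{..<n}. {\<omega>'::nat\<Rightarrow>bool. \<omega> i = \<omega>' i})"
    by (intro open_INT) auto
  also have "(\<Inter>i\<in>{..<n}. {\<omega>'::nat\<Rightarrow>bool. \<omega> i = \<omega>' i}) = {\<omega>'. agree n \<omega> \<omega>'}"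
    by (auto simp: agree_def)
  finally show ?thesis .
qed

text \<open>
  Tychonoff's theorem; it gives compactness of the pieces through the continuous coding.
\<close>

lemma compact_bool_sequences: "compact (UNIV :: (nat \<Rightarrow> bool) set)"
proof -
  have "compact_space (product_topology (\<lambda>_::nat. euclidean :: bool topology) UNIV)"
    unfolding compact_space_product_topology by (auto intro: finite_imp_compact simp: compact_space_def)
  then show ?thesis by (simp add: euclidean_product_topology compact_space_def)
qed

text \<open>
  The Cantor set of dimension \<open>c\<close> on the line spanned by the unit vector \<open>e\<close>. The contraction ratio
  \<open>rho\<close> is below \<open>1 / 2\<close> because \<open>c < 1\<close>, so that the two halves at every stage are separated by a gap.
\<close>

locale binary_cantor =
  fixes c :: real and e :: "'a::euclidean_space"
  assumes c: "0 < c" "c < 1" and norm_e: "norm e = 1"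
begin

definition rho :: real where "rho = 2 powr (- 1 / c)"

definition point :: "(nat \<Rightarrow> bool) \<Rightarrow> 'a" where
  "point \<omega> = (\<Sum>n. of_bool (\<omega> n) * rho ^ n) *\<^sub>R e"

text \<open>
  Points whose sequences first differ at position \<open>n\<close> have a distance between
  \<open>gap_const * rho ^ n\<close> and \<open>diam_const * rho ^ n\<close>.
\<close>

definition diam_const :: real where "diam_const = 1 / (1 - rho)"

definition gap_const :: real where "gap_const = 1 - rho * diam_const"

lemma rho: "0 < rho" "rho < 1 / 2" "rho < 1"
proof -
  have "- 1 / c < - 1" using c by (simp add: field_simps)
  then have "rho < 2 powr (- 1)" unfolding rho_def by (intro powr_less_mono) auto
  also have "\<dots> = 1 / 2" by (simp add: powr_minus_divide)
  finally show "rho < 1 / 2" .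
  then show "rho < 1" by simp
  show "0 < rho" by (simp add: rho_def)
qed

lemma ln_rho: "ln rho = - ln 2 / c"
  by (simp add: rho_def ln_powr)

lemma diam_const_pos: "0 < diam_const" using rho by (simp add: diam_const_def)

lemma gap_const_pos: "0 < gap_const"
  using rho by (simp add: gap_const_def diam_const_def field_simps)

text \<open>
  The level \<open>n\<close> at which \<open>K * rho ^ n\<close> first drops to \<open>r\<close> or below; \<open>level_le_iff\<close> says this without
  logarithms. It translates between radii and numbers of digits, with \<open>diam_const\<close> or \<open>gap_const\<close>
  in the place of \<open>K\<close>.
\<close>

definition level :: "real \<Rightarrow> real \<Rightarrow> nat" where
  "level K r = nat \<lceil>c * log 2 (K / r)\<rceil>"

lemma level_le_iff:
  assumes "0 < K" "0 < r"
  shows "level K r \<le> n \<longleftrightarrow> K * rho ^ n \<le> r"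
proof -
  have "level K r \<le> n \<longleftrightarrow> c * log 2 (K / r) \<le> real n"
    unfolding level_def by (simp add: nat_le_iff ceiling_le_iff)
  also have "\<dots> \<longleftrightarrow> log 2 (K / r) \<le> real n / c"
    using c by (simp add: field_simps)
  also have "\<dots> \<longleftrightarrow> K / r \<le> 2 powr (real n / c)"
    using assms by (subst log_le_iff) auto
  also have "2 powr (real n / c) = inverse (rho ^ n)"
    using rho(1) by (simp add: rho_def powr_realpow[symmetric] powr_powr powr_minus[symmetric])
  also have "K / r \<le> inverse (rho ^ n) \<longleftrightarrow> K * rho ^ n \<le> r"
    using assms rho(1) by (simp add: field_simps)
  finally show ?thesis .
qed

lemma filterlim_level:
  assumes "0 < K"
  shows "filterlim (level K) at_top (at_right 0)"
  unfolding filterlim_at_top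
proof
  fix n
  have "0 < K * rho ^ n" using assms rho by simp
  then have "eventually (\<lambda>r. r \<in> {0<..<K * rho ^ n}) (at_right 0)"
    by (rule eventually_at_right_real)
  then show "eventually (\<lambda>r. n \<le> level K r) (at_right 0)"
  proof eventually_elim
    case (elim r)
    then have "\<not> level K r \<le> n" using assms by (subst level_le_iff) auto
    then show ?case by simp
  qed
qed

text \<open>
  All choices of \<open>K\<close> give the same limit, so dimensions can be read off from the number of free digits
  below the level.
\<close>

lemma level_ratio_tendsto:
  assumes "0 < K"
  shows "((\<lambda>r. real (level K r) * ln 2 / - ln r) \<longlongrightarrow> c) (at_right 0)"
proof (rule tendsto_sandwich)
  have ev: "eventually (\<lambda>r. r \<in> {0<..<min 1 K}) (at_right 0)"
    by (rule eventually_at_right_real) (use assms in auto)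
  let ?f = "\<lambda>d r. c + (c * ln K + d * ln 2) / - ln r"
  have eq: "?f d r = (c * log 2 (K / r) + d) * ln 2 / - ln r" if "r \<in> {0<..<min 1 K}" for r d
  proof -
    have "ln r \<noteq> 0" using that by auto
    then show ?thesis using that assms by (simp add: log_def ln_div field_simps)
  qed
  show "eventually (\<lambda>r. ?f 0 r \<le> real (level K r) * ln 2 / - ln r) (at_right 0)"
    using ev
  proof eventually_elim
    case (elim r)
    have "c * log 2 (K / r) \<le> real (level K r)" unfolding level_def by linarith
    then show ?case unfolding eq[OF elim]
      using elim by (intro divide_right_mono mult_right_mono) auto
  qed
  show "eventually (\<lambda>r. real (level K r) * ln 2 / - ln r \<le> ?f 1 r) (at_right 0)"
    using ev
  proof eventually_elim
    case (elim r)
    have "0 \<le> c * log 2 (K / r)" using elim c by simp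
    then have "real (level K r) \<le> c * log 2 (K / r) + 1" unfolding level_def by linarith
    then show ?case unfolding eq[OF elim]
      using elim by (intro divide_right_mono mult_right_mono) auto
  qed
  have lim: "(?f d \<longlongrightarrow> c + 0) (at_right 0)" for d
    by (intro tendsto_add tendsto_const tendsto_divide_minus_ln)
  show "(?f 0 \<longlongrightarrow> c) (at_right 0)" "(?f 1 \<longlongrightarrow> c) (at_right 0)"
    using lim[of 0] lim[of 1] by simp_all
qed

lemma summable_digits: "summable (\<lambda>n. of_bool (\<omega> n) * rho ^ n)"
  by (rule summable_comparison_test'[of "\<lambda>n. rho ^ n" 0]) (use rho in auto)

lemma dist_point:
  "dist (point \<omega>) (point \<omega>') = \<bar>\<Sum>n. (of_bool (\<omega> n) - of_bool (\<omega>' n)) * rho ^ n\<bar>"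
proof -
  have "point \<omega> - point \<omega>' = (\<Sum>n. (of_bool (\<omega> n) - of_bool (\<omega>' n)) * rho ^ n) *\<^sub>R e"
    unfolding point_def scaleR_left_diff_distrib[symmetric]
    by (subst suminf_diff[OF summable_digits summable_digits]) (simp add: left_diff_distrib)
  then show ?thesis by (simp add: dist_norm norm_e)
qed

lemma dist_point_le:
  assumes "agree n \<omega> \<omega>'"
  shows "dist (point \<omega>) (point \<omega>') \<le> diam_const * rho ^ n"
proof -
  let ?d = "\<lambda>i. (of_bool (\<omega> i) - of_bool (\<omega>' i)) * rho ^ i"
  have bd: "norm (?d i) \<le> rho ^ i" for i using rho by simp
  have sm: "summable ?d" by (rule summable_comparison_test'[of "\<lambda>n. rho ^ n" 0]) (use rho bd in auto)
  have "(\<Sum>i. ?d i) = (\<Sum>i. ?d (i + n)) + (\<Sum>i<n. ?d i)"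
    by (rule suminf_split_initial_segment[OF sm])
  also have "(\<Sum>i<n. ?d i) = 0"
    using assms by (intro sum.neutral) (auto simp: agree_def)
  finally have eq: "(\<Sum>i. ?d i) = (\<Sum>i. ?d (i + n))" by simp
  have "norm (\<Sum>i. ?d (i + n)) \<le> (\<Sum>i. rho ^ i * rho ^ n)"
  proof (rule norm_suminf_le)
    show "norm (?d (i + n)) \<le> rho ^ i * rho ^ n" for i using bd[of "i + n"] by (simp add: power_add)
    show "summable (\<lambda>i. rho ^ i * rho ^ n)" using rho by (intro summable_mult2) auto
  qed
  also have "\<dots> = diam_const * rho ^ n"
    using rho by (subst suminf_mult2[symmetric]) (auto simp: suminf_geometric diam_const_def)
  finally show ?thesis unfolding dist_point eq by simp
qed

text \<open>
  At the first position \<open>m\<close> where the sequences differ, change the digit of one of them. That point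
  moves by exactly \<open>rho ^ m\<close> and ends up within \<open>diam_const * rho ^ (m + 1)\<close> of the other one, since the
  two sequences now agree up to and including position \<open>m\<close>. As \<open>rho < 1 / 2\<close>, the first distance
  exceeds the second.
\<close>

lemma dist_point_ge:
  assumes "\<not> agree (Suc n) \<omega> \<omega>'"
  shows "gap_const * rho ^ n \<le> dist (point \<omega>) (point \<omega>')"
proof -
  define m where "m = (LEAST m. \<omega> m \<noteq> \<omega>' m)"
  obtain k where k: "k \<le> n" "\<omega> k \<noteq> \<omega>' k"
    using assms by (auto simp: agree_def less_Suc_eq_le)
  have m: "\<omega> m \<noteq> \<omega>' m" unfolding m_def by (rule LeastI) (rule k(2))
  have "m \<le> k" unfolding m_def by (rule Least_le) (rule k(2))
  then have mn: "m \<le> n" using k by simp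
  have below: "\<omega> i = \<omega>' i" if "i < m" for i
    using not_less_Least[of i "\<lambda>m. \<omega> m \<noteq> \<omega>' m"] that unfolding m_def by auto
  define \<eta> where "\<eta> = \<omega>'(m := \<omega> m)"
  have "agree (Suc m) \<omega> \<eta>" using below by (auto simp: agree_def \<eta>_def less_Suc_eq)
  from dist_point_le[OF this] have 1: "dist (point \<omega>) (point \<eta>) \<le> diam_const * rho ^ Suc m" .
  have "(\<Sum>i. (of_bool (\<eta> i) - of_bool (\<omega>' i)) * rho ^ i) = (of_bool (\<omega> m) - of_bool (\<omega>' m)) * rho ^ m"
    by (subst suminf_finite[of "{m}"]) (auto simp: \<eta>_def)
  then have 2: "dist (point \<eta>) (point \<omega>') = rho ^ m"
    unfolding dist_point using m rho by auto
  have "gap_const * rho ^ n \<le> gap_const * rho ^ m"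
    using gap_const_pos rho mn by (intro mult_left_mono power_decreasing) auto
  also have "\<dots> = rho ^ m - diam_const * rho ^ Suc m"
    by (simp add: gap_const_def algebra_simps)
  also have "\<dots> \<le> dist (point \<omega>) (point \<omega>')"
    using 1 2 dist_triangle[of "point \<eta>" "point \<omega>'" "point \<omega>"] by (simp add: dist_commute)
  finally show ?thesis .
qed

lemma agree_level_imp_dist_le:
  assumes "agree (level diam_const r) \<omega> \<omega>'" "0 < r"
  shows "dist (point \<omega>) (point \<omega>') \<le> r"
  using dist_point_le[OF assms(1)] level_le_iff[OF diam_const_pos assms(2), of "level diam_const r"]
  by simp

lemma dist_le_imp_agree_level:
  assumes "dist (point \<omega>) (point \<omega>') \<le> r" "0 < r"
  shows "agree (level gap_const r) \<omega> \<omega>'"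
proof (cases "level gap_const r")
  case 0
  then show ?thesis by (simp add: agree_def)
next
  case (Suc n)
  then have "\<not> level gap_const r \<le> n" by simp
  then have "r < gap_const * rho ^ n" using level_le_iff[OF gap_const_pos assms(2)] by simp
  then show ?thesis using dist_point_ge[of n \<omega> \<omega>'] assms(1) Suc by fastforce
qed

lemma continuous_on_point: "continuous_on UNIV point"
  unfolding continuous_on_def
proof (intro ballI tendstoI)
  fix \<omega> :: "nat \<Rightarrow> bool" and \<epsilon> :: real assume \<epsilon>: "0 < \<epsilon>"
  let ?n = "level diam_const (\<epsilon> / 2)"
  have "eventually (\<lambda>\<omega>'. \<omega>' \<in> {\<omega>'. agree ?n \<omega> \<omega>'}) (at \<omega> within UNIV)"
    by (intro eventually_at_in_open' open_agree) simp
  then show "eventually (\<lambda>\<omega>'. dist (point \<omega>') (point \<omega>) < \<epsilon>) (at \<omega> within UNIV)"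
  proof eventually_elim
    case (elim \<omega>')
    then show ?case using agree_level_imp_dist_le[of "\<epsilon> / 2" \<omega> \<omega>'] \<epsilon>
      by (auto simp: dist_commute)
  qed
qed

text \<open>
  The hypothesis says that the complement of \<open>T\<close> is open: membership in it is witnessed by a prefix.
\<close>

lemma compact_point_image:
  assumes "\<And>\<omega>. \<omega> \<notin> T \<Longrightarrow> \<exists>n. \<forall>\<omega>'. agree n \<omega> \<omega>' \<longrightarrow> \<omega>' \<notin> T"
  shows "compact (point ` T)"
proof (rule compact_continuous_image)
  show "continuous_on T point" using continuous_on_point continuous_on_subset by blast
  have "open (- T)"
    unfolding open_subopen[of "- T"]
  proof
    fix \<omega> assume "\<omega> \<in> - T"
    then obtain n where "\<forall>\<omega>'. agree n \<omega> \<omega>' \<longrightarrow> \<omega>' \<notin> T" using assms by blast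
    then show "\<exists>U. open U \<and> \<omega> \<in> U \<and> U \<subseteq> - T"
      by (intro exI[of _ "{\<omega>'. agree n \<omega> \<omega>'}"]) (auto simp: open_agree)
  qed
  then show "compact T" using compact_Int_closed[OF compact_bool_sequences, of T]
    by (simp add: closed_def)
qed

text \<open>
  One ball for each possible prefix of length \<open>n\<close>. The centres are taken with zeros from position \<open>n\<close>
  on; they need not belong to the covered set.
\<close>

lemma covered_point_image:
  assumes "finite J" "\<And>\<omega> i. \<omega> \<in> T \<Longrightarrow> i < n \<Longrightarrow> \<omega> i \<Longrightarrow> i \<in> J" "diam_const * rho ^ n \<le> s"
  shows "covered_by_balls (2 ^ card J) s (point ` T)"
  unfolding covered_by_balls_def
proof (intro exI conjI)
  let ?X = "(\<lambda>W. point (\<lambda>i. i \<in> W)) ` Pow J"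
  show "finite ?X" using assms(1) by simp
  show "card ?X \<le> 2 ^ card J"
    using card_image_le[of "Pow J"] assms(1) by (simp add: card_Pow)
  show "point ` T \<subseteq> (\<Union>x\<in>?X. cball x s)"
  proof
    fix x assume "x \<in> point ` T"
    then obtain \<omega> where \<omega>: "\<omega> \<in> T" "x = point \<omega>" by auto
    let ?W = "{i. i < n \<and> \<omega> i}"
    have "agree n (\<lambda>i. i \<in> ?W) \<omega>" by (auto simp: agree_def)
    from dist_point_le[OF this] have "x \<in> cball (point (\<lambda>i. i \<in> ?W)) s"
      using assms(3) \<omega> by simp
    moreover have "?W \<in> Pow J" using assms(2) \<omega> by auto
    ultimately show "x \<in> (\<Union>x\<in>?X. cball x s)" by blast
  qed
qed

end

section \<open>The coin-tossing measure on the Cantor set\<close>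

definition coin_space :: "(nat \<Rightarrow> bool) measure" where
  "coin_space = Pi\<^sub>M UNIV (\<lambda>_. uniform_count_measure (UNIV :: bool set))"

lemma prob_space_coin_space: "prob_space coin_space"
  unfolding coin_space_def
  by (intro prob_space_PiM prob_space_uniform_count_measure) auto

lemma space_coin_space [simp]: "space coin_space = UNIV"
  by (simp add: coin_space_def space_PiM space_uniform_count_measure)

lemma measurable_coin [measurable]: "(\<lambda>\<omega>. \<omega> i) \<in> measurable coin_space (count_space UNIV)"
proof -
  have "(\<lambda>\<omega>. \<omega> i) \<in> measurable coin_space (uniform_count_measure (UNIV :: bool set))"
    unfolding coin_space_def by (rule measurable_component_singleton) simp
  then show ?thesis
    by (simp add: measurable_def sets_uniform_count_measure space_uniform_count_measure)
qed

lemma measure_coin_cylinder: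
  assumes "finite J"
  shows "measure coin_space {\<omega>'. \<forall>i\<in>J. \<omega>' i = \<omega> i} = (1 / 2) ^ card J"
proof -
  interpret P: product_prob_space "\<lambda>_::nat. uniform_count_measure (UNIV :: bool set)" UNIV
    by (intro product_prob_spaceI prob_space_uniform_count_measure) auto
  have m: "measure (uniform_count_measure UNIV) {b} = 1 / 2" for b :: bool
    by (simp add: measure_uniform_count_measure)
  have 1: "emeasure (uniform_count_measure UNIV) {b} = ennreal (1 / 2)" for b :: bool
    unfolding P.M.emeasure_eq_measure m ..
  have "emeasure coin_space {\<omega>' \<in> space coin_space. \<forall>i\<in>J. \<omega>' i \<in> {\<omega> i}} = (\<Prod>i\<in>J. ennreal (1 / 2))"
    unfolding coin_space_def
    using assms by (subst P.emeasure_PiM_Collect) (auto simp: sets_uniform_count_measure 1)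
  also have "\<dots> = ennreal ((1 / 2) ^ card J)"
    by (subst prod_constant) (rule ennreal_power, simp)
  finally show ?thesis by (simp add: measure_def)
qed

lemma sets_coin_cylinder:
  assumes "finite J"
  shows "{\<omega>'. \<forall>i\<in>J. \<omega>' i = \<omega> i} \<in> sets coin_space"
proof -
  have "{\<omega>' \<in> space coin_space. \<forall>i\<in>J. \<omega>' i = \<omega> i} \<in> sets coin_space"
    using assms by measurable
  then show ?thesis by simp
qed

context binary_cantor
begin

definition coin_measure :: "nat set \<Rightarrow> 'a measure" where
  "coin_measure D = distr coin_space borel (\<lambda>\<omega>. point (\<lambda>n. \<omega> n \<and> n \<in> D))"

lemma measurable_coin_point [measurable]:
  "(\<lambda>\<omega>. point (\<lambda>n. \<omega> n \<and> n \<in> D)) \<in> borel_measurable coin_space"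
  unfolding point_def by measurable

lemma prob_space_coin_measure: "prob_space (coin_measure D)"
  unfolding coin_measure_def
  by (intro prob_space.prob_space_distr prob_space_coin_space) measurable

lemma sets_coin_measure [simp]: "sets (coin_measure D) = sets borel"
  by (simp add: coin_measure_def)

lemma measure_coin_measure:
  assumes "A \<in> sets borel"
  shows "measure (coin_measure D) A = measure coin_space {\<omega>. point (\<lambda>n. \<omega> n \<and> n \<in> D) \<in> A}"
  using assms unfolding coin_measure_def
  by (subst measure_distr) (auto simp: vimage_def)

lemma coin_measure_in_borel_prob_measures_on:
  assumes "E \<in> sets borel" "\<And>\<omega>. (\<And>n. \<omega> n \<Longrightarrow> n \<in> D) \<Longrightarrow> point \<omega> \<in> E"
  shows "coin_measure D \<in> borel_prob_measures_on E"
proof -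
  interpret prob_space "coin_measure D" by (rule prob_space_coin_measure)
  have "point (\<lambda>n. \<omega> n \<and> n \<in> D) \<in> E" for \<omega> by (rule assms(2)) simp
  then have "{\<omega>. point (\<lambda>n. \<omega> n \<and> n \<in> D) \<in> UNIV - E} = {}" by simp
  then have "measure (coin_measure D) (UNIV - E) = 0"
    using assms(1) by (subst measure_coin_measure) auto
  then show ?thesis
    unfolding borel_prob_measures_on_def
    using prob_space_coin_measure by (simp add: emeasure_eq_measure)
qed

text \<open>
  Two points of the ball are at distance at most \<open>2 * r\<close>, so their sequences share the first
  \<open>level gap_const (2 * r)\<close> digits, and the coins at the positions in \<open>D\<close> below this level are forced.
\<close>

lemma coin_measure_cball_le:
  assumes "0 < r"
  shows "measure (coin_measure D) (cball x r) \<le> (1 / 2) ^ card (D \<inter> {..<level gap_const (2 * r)})"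
proof -
  interpret C: prob_space coin_space by (rule prob_space_coin_space)
  let ?J = "D \<inter> {..<level gap_const (2 * r)}"
  let ?S = "{\<omega>. point (\<lambda>n. \<omega> n \<and> n \<in> D) \<in> cball x r}"
  have "measure coin_space ?S \<le> (1 / 2) ^ card ?J"
  proof (cases "?S = {}")
    case True
    then show ?thesis by simp
  next
    case False
    then obtain \<omega> where \<omega>: "point (\<lambda>n. \<omega> n \<and> n \<in> D) \<in> cball x r" by auto
    have "?S \<subseteq> {\<omega>'. \<forall>i\<in>?J. \<omega>' i = \<omega> i}"
    proof (intro subsetI CollectI ballI)
      fix \<omega>' i
      assume "\<omega>' \<in> ?S" "i \<in> ?J"
      then have \<omega>': "point (\<lambda>n. \<omega>' n \<and> n \<in> D) \<in> cball x r" and i: "i < level gap_const (2 * r)" "i \<in> D"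
        by auto
      have "dist (point (\<lambda>n. \<omega> n \<and> n \<in> D)) (point (\<lambda>n. \<omega>' n \<and> n \<in> D)) \<le> 2 * r"
        using \<omega> \<omega>' dist_triangle[of "point (\<lambda>n. \<omega> n \<and> n \<in> D)" "point (\<lambda>n. \<omega>' n \<and> n \<in> D)" x]
        by (simp add: dist_commute)
      from dist_le_imp_agree_level[OF this] assms i
      show "\<omega>' i = \<omega> i" by (auto simp: agree_def)
    qed
    then have "measure coin_space ?S \<le> measure coin_space {\<omega>'. \<forall>i\<in>?J. \<omega>' i = \<omega> i}"
      by (intro C.finite_measure_mono sets_coin_cylinder) auto
    also have "\<dots> = (1 / 2) ^ card ?J" by (rule measure_coin_cylinder) simp
    finally show ?thesis .
  qed
  then show ?thesis by (subst measure_coin_measure) auto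
qed

text \<open>
  The reverse bound on the full Cantor set. It makes the measure of a ball comparable to \<open>r powr c\<close>,
  which controls packings by disjointness.
\<close>

lemma coin_measure_UNIV_cball_ge:
  assumes "0 < r"
  shows "(1 / 2) ^ level diam_const r \<le> measure (coin_measure UNIV) (cball (point \<omega>) r)"
proof -
  interpret C: prob_space coin_space by (rule prob_space_coin_space)
  let ?J = "{..<level diam_const r}"
  have "{\<omega>'. \<forall>i\<in>?J. \<omega>' i = \<omega> i} \<subseteq> {\<omega>'. point \<omega>' \<in> cball (point \<omega>) r}"
    using agree_level_imp_dist_le[of r \<omega>] assms by (auto simp: agree_def)
  moreover have "{\<omega>'. point \<omega>' \<in> cball (point \<omega>) r} \<in> sets coin_space"
    using measurable_sets[OF measurable_coin_point[of UNIV], of "cball (point \<omega>) r"]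
    by (simp add: vimage_def)
  ultimately have "measure coin_space {\<omega>'. \<forall>i\<in>?J. \<omega>' i = \<omega> i}
      \<le> measure coin_space {\<omega>'. point \<omega>' \<in> cball (point \<omega>) r}"
    by (rule C.finite_measure_mono)
  then show ?thesis
    by (subst measure_coin_measure) (simp_all add: measure_coin_cylinder)
qed

end

section \<open>Dimension estimates from counting digits\<close>

context binary_cantor
begin

lemma filterlim_scale:
  assumes "0 < K" "filterlim N at_top sequentially"
  shows "filterlim (\<lambda>k. K * rho ^ N k) (at_right 0) sequentially"
proof -
  have "(\<lambda>n. K * rho ^ n) \<longlonglongrightarrow> K * 0"
    using rho by (intro tendsto_intros LIMSEQ_realpow_zero) auto
  then have "(\<lambda>k. K * rho ^ N k) \<longlonglongrightarrow> 0"
    using filterlim_compose[OF _ assms(2)] by simp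
  then show ?thesis
    using assms rho by (intro filterlim_at_withinI eventuallyI) auto
qed

lemma scale_ratio_tendsto:
  assumes "0 < K" "filterlim N at_top sequentially"
  shows "(\<lambda>k. real (N k) * ln 2 / - ln (K * rho ^ N k)) \<longlonglongrightarrow> c"
proof -
  have inf: "filterlim (\<lambda>k. real (N k)) at_infinity sequentially"
    by (intro filterlim_at_top_imp_at_infinity filterlim_compose[OF filterlim_real_sequentially assms(2)])
  have "(\<lambda>k. ln 2 / (ln 2 / c - ln K / real (N k))) \<longlonglongrightarrow> ln 2 / (ln 2 / c - 0)"
    using c by (intro tendsto_intros tendsto_divide_0[OF tendsto_const inf]) auto
  moreover have "eventually (\<lambda>k. ln 2 / (ln 2 / c - ln K / real (N k)) = real (N k) * ln 2 / - ln (K * rho ^ N k)) sequentially"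
    using eventually_compose_filterlim[OF eventually_gt_at_top[of 0] assms(2)]
  proof eventually_elim
    case (elim k)
    have "- ln (K * rho ^ N k) = real (N k) * (ln 2 / c - ln K / real (N k))"
      using assms rho elim by (simp add: ln_mult ln_realpow ln_rho right_diff_distrib)
    then show ?case using elim by simp
  qed
  ultimately show ?thesis using c by (simp add: filterlim_cong)
qed

text \<open>
  For a lower limit a sequence of levels \<open>N k\<close> is enough. There are at most \<open>2 ^ card (J k)\<close> prefixes of
  length \<open>N k\<close>.
\<close>

lemma lower_box_dim_point_image_le:
  assumes N: "filterlim N at_top sequentially"
    and J: "\<And>k. finite (J k)" "\<And>k \<omega> i. \<omega> \<in> T \<Longrightarrow> i < N k \<Longrightarrow> \<omega> i \<Longrightarrow> i \<in> J k"
    and l: "eventually (\<lambda>k. real (card (J k)) \<le> u k * real (N k)) sequentially" "u \<longlonglongrightarrow> l"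
  shows "lower_box_dim (point ` T) \<le> ereal (c * l)"
proof -
  let ?K = "2 * diam_const"
  let ?r = "\<lambda>k. ?K * rho ^ N k"
  have K: "0 < ?K" using diam_const_pos by simp
  have r: "filterlim ?r (at_right 0) sequentially" by (rule filterlim_scale[OF K N])
  have "eventually (\<lambda>r. r \<in> {0<..<1}) (at_right (0::real))" by (rule eventually_at_right_real) simp
  from eventually_compose_filterlim[OF this r]
  have ev: "eventually (\<lambda>k. 0 < ?r k \<and> ?r k < 1) sequentially" by simp
  show ?thesis unfolding lower_box_dim_def
  proof (rule Liminf_le_lim_along[OF r])
    show "(\<lambda>k. (real (N k) * ln 2 / - ln (?r k)) * u k) \<longlonglongrightarrow> c * l"
      by (intro tendsto_mult scale_ratio_tendsto K N l)
    show "eventually (\<lambda>k. ln (real (covering_number (?r k) (point ` T))) / - ln (?r k)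
        \<le> real (N k) * ln 2 / - ln (?r k) * u k) sequentially"
      using ev l(1)
    proof eventually_elim
      case (elim k)
      let ?n = "covering_number (?r k) (point ` T)"
      have "covered_by_balls (2 ^ card (J k)) (?r k / 2) (point ` T)"
        by (rule covered_point_image[where n = "N k"]) (use J in auto)
      then have le: "?n \<le> 2 ^ card (J k)" using elim by (intro covering_number_witness) auto
      have "ln (real ?n) \<le> real (card (J k)) * ln 2"
      proof (cases "?n = 0")
        case False
        have "real ?n \<le> 2 ^ card (J k)" using le by (metis of_nat_le_iff of_nat_numeral of_nat_power)
        then have "ln (real ?n) \<le> ln (2 ^ card (J k))" using False by (intro ln_mono) auto
        then show ?thesis by (simp add: ln_realpow)
      qed simp
      also have "\<dots> \<le> u k * real (N k) * ln 2" using elim by (intro mult_right_mono) auto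
      finally have "ln (real ?n) / - ln (?r k) \<le> u k * real (N k) * ln 2 / - ln (?r k)"
        using elim by (intro divide_right_mono) auto
      then show ?case by (simp add: mult_ac)
    qed
  qed
qed

text \<open>
  The set \<open>A\<close> may depend on the scale; only its mass has to stay above \<open>p\<close>. This freedom is what makes the
  targeted piece small for the correlation dimension.
\<close>

lemma upper_correlation_dim_measure_le:
  assumes \<mu>: "prob_space \<mu>" "sets \<mu> = sets borel" and p: "0 < p"
    and A: "eventually (\<lambda>n. \<exists>A\<in>sets borel. p \<le> measure \<mu> A \<and>
        (\<exists>j. real j \<le> \<beta> * real n \<and> covered_by_balls (2 ^ j) (diam_const * rho ^ n) A)) sequentially"
  shows "upper_correlation_dim_measure \<mu> \<le> ereal (c * \<beta>)"
proof -
  let ?K = "2 * diam_const"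
  let ?I = "\<lambda>r. LINT x|\<mu>. measure \<mu> (cball x r)"
  \<comment> \<open>the bound \<open>p\<^sup>2 / (4 * 2 ^ j)\<close> on the correlation integral, on the logarithmic scale\<close>
  let ?h = "\<lambda>r. (- ln (p\<^sup>2 / 4)) / - ln r + real (level ?K r) * ln 2 / - ln r * \<beta>"
  have K: "0 < ?K" using diam_const_pos by simp
  have "(?h \<longlongrightarrow> 0 + c * \<beta>) (at_right 0)"
    by (intro tendsto_intros tendsto_divide_minus_ln level_ratio_tendsto K)
  then have lim: "((\<lambda>r. ereal (?h r)) \<longlongrightarrow> ereal (c * \<beta>)) (at_right 0)" by simp
  have "eventually (\<lambda>r. r \<in> {0<..<1}) (at_right (0::real))" by (rule eventually_at_right_real) simp
  then have "eventually (\<lambda>r. ereal (ln (?I r) / ln r) \<le> ereal (?h r)) (at_right 0)"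
    using eventually_compose_filterlim[OF A filterlim_level[OF K]]
  proof eventually_elim
    case (elim r)
    let ?n = "level ?K r"
    obtain A j where A: "A \<in> sets borel" "p \<le> measure \<mu> A" "real j \<le> \<beta> * real ?n"
      "covered_by_balls (2 ^ j) (diam_const * rho ^ ?n) A" using elim by blast
    have "?K * rho ^ ?n \<le> r" using level_le_iff[OF K, of r ?n] elim by simp
    then have "covered_by_balls (2 ^ j) (r / 2) A"
      using A(4) by (rule_tac covered_by_balls_mono) auto
    from correlation_integral_ge[OF \<mu> A(1) this]
    have "(measure \<mu> A)\<^sup>2 / (4 * 2 ^ j) \<le> ?I r" by simp
    moreover have "p\<^sup>2 / (4 * 2 ^ j) \<le> (measure \<mu> A)\<^sup>2 / (4 * 2 ^ j)"
      using A p by (intro divide_right_mono power_mono) auto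
    ultimately have le: "p\<^sup>2 / 4 / 2 ^ j \<le> ?I r" by simp
    have "ln (p\<^sup>2 / 4 / 2 ^ j) \<le> ln (?I r)"
      by (rule ln_mono[OF le]) (use p in simp)
    also have "ln (p\<^sup>2 / 4 / 2 ^ j) = ln (p\<^sup>2 / 4) - real j * ln 2"
      using p by (subst ln_div) (auto simp: ln_realpow)
    finally have "- ln (?I r) \<le> - ln (p\<^sup>2 / 4) + real j * ln 2" by simp
    also have "real j * ln 2 \<le> \<beta> * real ?n * ln 2" using A by (intro mult_right_mono) auto
    finally have "- ln (?I r) \<le> - ln (p\<^sup>2 / 4) + \<beta> * real ?n * ln 2" by simp
    then have "- ln (?I r) / - ln r \<le> (- ln (p\<^sup>2 / 4) + \<beta> * real ?n * ln 2) / - ln r"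
      using elim by (intro divide_right_mono) auto
    also have "\<dots> = ?h r" by (simp only: add_divide_distrib) (simp add: mult_ac)
    finally show ?case by simp
  qed
  then have "upper_correlation_dim_measure \<mu> \<le> Limsup (at_right 0) (\<lambda>r. ereal (?h r))"
    unfolding upper_correlation_dim_measure_def by (rule Limsup_mono)
  also have "\<dots> = ereal (c * \<beta>)" by (rule lim_imp_Limsup[OF _ lim]) simp
  finally show ?thesis .
qed

text \<open>
  The mass distribution principle: a set of diameter \<open>r\<close> has mass at most \<open>2\<close> to the minus number of
  digits in \<open>D\<close> below the level of \<open>r\<close>, so a set of positive mass needs many of them. The sets in a
  cover need not be measurable and are replaced by balls of radius \<open>r\<close>.
\<close>

lemma lower_box_dim_ge:
  assumes F: "compact F" "measure (coin_measure D) F > 0"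
    and D: "\<And>n. \<alpha> * real n - 1 \<le> real (card (D \<inter> {..<n}))"
  shows "ereal (c * \<alpha>) \<le> lower_box_dim F"
proof -
  interpret prob_space "coin_measure D" by (rule prob_space_coin_measure)
  let ?K = "gap_const / 2"
  define p where "p = measure (coin_measure D) F"
  have p: "0 < p" using F by (simp add: p_def)
  let ?h = "\<lambda>r. (ln p - ln 2) / - ln r + real (level ?K r) * ln 2 / - ln r * \<alpha>"
  have K: "0 < ?K" using gap_const_pos by simp
  have "(?h \<longlongrightarrow> 0 + c * \<alpha>) (at_right 0)"
    by (intro tendsto_intros tendsto_divide_minus_ln level_ratio_tendsto K)
  then have lim: "((\<lambda>r. ereal (?h r)) \<longlongrightarrow> ereal (c * \<alpha>)) (at_right 0)" by simp
  have "eventually (\<lambda>r. r \<in> {0<..<1}) (at_right (0::real))" by (rule eventually_at_right_real) simp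
  then have "eventually (\<lambda>r. ereal (?h r) \<le> ereal (ln (real (covering_number r F)) / - ln r)) (at_right 0)"
  proof eventually_elim
    case (elim r)
    then have r: "0 < r" "r < 1" by auto
    let ?m = "card (D \<inter> {..<level ?K r})"
    have lev: "level gap_const (2 * r) = level ?K r" by (simp add: level_def)
    obtain N where "covered_by_balls N (r / 2) F"
      using compact_imp_covered_by_balls[of F "r / 2"] F r by auto
    from covering_number_witness(2)[OF this] r
    obtain \<C> where \<C>: "finite \<C>" "card \<C> = covering_number r F" "F \<subseteq> \<Union>\<C>"
      "\<And>U. U \<in> \<C> \<Longrightarrow> bounded U \<and> diameter U = r" by auto
    define x where "x U = (SOME x. x \<in> U)" for U :: "'a set"
    have sub: "U \<subseteq> cball (x U) r" if "U \<in> \<C>" for U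
    proof
      fix y assume y: "y \<in> U"
      then have "x U \<in> U" unfolding x_def by (rule someI)
      then have "dist (x U) y \<le> diameter U"
        using \<C>(4)[OF that] y by (intro diameter_bounded_bound) auto
      then show "y \<in> cball (x U) r" using \<C>(4)[OF that] by simp
    qed
    have "p \<le> measure (coin_measure D) (\<Union>U\<in>\<C>. cball (x U) r)"
      unfolding p_def
    proof (rule finite_measure_mono)
      show "F \<subseteq> (\<Union>U\<in>\<C>. cball (x U) r)" using \<C>(3) sub by blast
      show "(\<Union>U\<in>\<C>. cball (x U) r) \<in> sets (coin_measure D)" using \<C>(1) by auto
    qed
    also have "\<dots> \<le> (\<Sum>U\<in>\<C>. measure (coin_measure D) (cball (x U) r))"
      using \<C> by (intro finite_measure_subadditive_finite) auto
    also have "\<dots> \<le> real (card \<C>) * (1 / 2) ^ ?m"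
      using coin_measure_cball_le[OF r(1), of D] by (intro sum_bounded_above) (simp add: lev)
    finally have "p * 2 ^ ?m \<le> real (covering_number r F)"
      using \<C> by (simp add: power_divide field_simps)
    then have "ln (p * 2 ^ ?m) \<le> ln (real (covering_number r F))"
      using p by (intro ln_mono) auto
    then have "ln p + real ?m * ln 2 \<le> ln (real (covering_number r F))"
      using p by (simp add: ln_mult ln_realpow)
    moreover have "(\<alpha> * real (level ?K r) - 1) * ln 2 \<le> real ?m * ln 2"
      by (intro mult_right_mono D) auto
    ultimately have "ln p - ln 2 + \<alpha> * real (level ?K r) * ln 2 \<le> ln (real (covering_number r F))"
      by (simp add: left_diff_distrib)
    then have "(ln p - ln 2 + \<alpha> * real (level ?K r) * ln 2) / - ln r
        \<le> ln (real (covering_number r F)) / - ln r"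
      using r by (intro divide_right_mono) auto
    moreover have "(ln p - ln 2 + \<alpha> * real (level ?K r) * ln 2) / - ln r = ?h r"
      by (simp only: add_divide_distrib) (simp add: mult_ac)
    ultimately show ?case by simp
  qed
  then have "Liminf (at_right 0) (\<lambda>r. ereal (?h r)) \<le> lower_box_dim F"
    unfolding lower_box_dim_def by (rule Liminf_mono)
  then show ?thesis using lim_imp_Liminf[OF _ lim] by simp
qed

text \<open>
  The measure of every ball of radius about \<open>rho ^ N k\<close>, and hence the correlation integral, is at most
  \<open>2\<close> to the minus number of digits in \<open>D\<close> below \<open>N k\<close>.
\<close>

lemma upper_correlation_dim_coin_measure_ge:
  assumes N: "filterlim N at_top sequentially"
    and u: "eventually (\<lambda>k. u k * real (N k) \<le> real (card (D \<inter> {..<N k}))) sequentially" "u \<longlonglongrightarrow> \<beta>"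
  shows "ereal (c * \<beta>) \<le> upper_correlation_dim_measure (coin_measure D)"
proof -
  interpret prob_space "coin_measure D" by (rule prob_space_coin_measure)
  let ?K = "gap_const / 2"
  let ?r = "\<lambda>k. ?K * rho ^ N k"
  let ?I = "\<lambda>r. LINT x|coin_measure D. measure (coin_measure D) (cball x r)"
  have K: "0 < ?K" using gap_const_pos by simp
  have r: "filterlim ?r (at_right 0) sequentially" by (rule filterlim_scale[OF K N])
  have "eventually (\<lambda>r. r \<in> {0<..<1}) (at_right (0::real))" by (rule eventually_at_right_real) simp
  from eventually_compose_filterlim[OF this r]
  have ev: "eventually (\<lambda>k. 0 < ?r k \<and> ?r k < 1) sequentially" by simp
  \<comment> \<open>positivity is needed because \<open>ln 0 = 0\<close> would spoil the monotonicity of the logarithm\<close>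
  have pos: "0 < ?I s" if s: "0 < s" for s
  proof -
    let ?A = "point ` UNIV"
    have cA: "compact ?A" by (rule compact_point_image) simp
    then have A: "?A \<in> sets borel" by (simp add: borel_compact)
    have "coin_measure D \<in> borel_prob_measures_on ?A"
      by (rule coin_measure_in_borel_prob_measures_on[OF A]) simp
    then have "emeasure (coin_measure D) (UNIV - ?A) = 0" by (simp add: borel_prob_measures_on_def)
    then have "measure (coin_measure D) (UNIV - ?A) = 0" by (simp add: measure_def)
    moreover have "space (coin_measure D) = UNIV" by (simp add: coin_measure_def)
    ultimately have m: "measure (coin_measure D) ?A = 1"
      using prob_compl[of ?A] A by simp
    obtain M where M: "covered_by_balls M (s / 2) ?A"
      using compact_imp_covered_by_balls[OF cA, of "s / 2"] s by auto
    then have "covered_by_balls (Suc M) (s / 2) ?A" by (rule covered_by_balls_mono) auto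
    from correlation_integral_ge[OF prob_space_coin_measure[of D] sets_coin_measure A this]
    have "1 / (4 * real (Suc M)) \<le> ?I s" unfolding m by simp
    then show ?thesis by (rule less_le_trans[rotated]) simp
  qed
  have "ereal (c * \<beta>) \<le> Limsup (at_right 0) (\<lambda>r. ereal (ln (?I r) / ln r))"
  proof (rule Limsup_ge_lim_along[OF r])
    show "(\<lambda>k. (real (N k) * ln 2 / - ln (?r k)) * u k) \<longlonglongrightarrow> c * \<beta>"
      by (intro tendsto_mult scale_ratio_tendsto K N u)
    show "eventually (\<lambda>k. real (N k) * ln 2 / - ln (?r k) * u k \<le> ln (?I (?r k)) / ln (?r k)) sequentially"
      using ev u(1)
    proof eventually_elim
      case (elim k)
      let ?m = "card (D \<inter> {..<N k})"
      have "N k \<le> level gap_const (2 * ?r k)"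
      proof (cases "N k")
        case (Suc n)
        have "gap_const * rho ^ N k < gap_const * rho ^ n"
          using gap_const_pos rho Suc by simp
        then have "\<not> level gap_const (2 * ?r k) \<le> n"
          using level_le_iff[OF gap_const_pos, of "2 * ?r k" n] elim by simp
        then show ?thesis using Suc by simp
      qed simp
      then have m: "?m \<le> card (D \<inter> {..<level gap_const (2 * ?r k)})"
        by (intro card_mono) auto
      have "?I (?r k) \<le> (LINT x|coin_measure D. (1 / 2) ^ ?m)"
      proof (rule integral_mono)
        show "integrable (coin_measure D) (\<lambda>x. measure (coin_measure D) (cball x (?r k)))"
          using borel_measurable_measure_cball[OF prob_space_coin_measure sets_coin_measure]
          by (intro integrable_const_bound[where B=1]) auto
        show "measure (coin_measure D) (cball x (?r k)) \<le> (1 / 2) ^ ?m" for x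
        proof -
          have "(1 / 2 :: real) ^ card (D \<inter> {..<level gap_const (2 * ?r k)}) \<le> (1 / 2) ^ ?m"
            by (rule power_decreasing[OF m]) auto
          then show ?thesis using coin_measure_cball_le[of "?r k" D x] elim by linarith
        qed
      qed simp
      also have "\<dots> = (1 / 2) ^ ?m" by (simp add: prob_space)
      finally have "ln (?I (?r k)) \<le> ln ((1 / 2) ^ ?m)"
        using pos[of "?r k"] elim by (intro ln_mono) auto
      then have "real ?m * ln 2 \<le> - ln (?I (?r k))" by (simp add: ln_realpow ln_div)
      moreover have "u k * real (N k) * ln 2 \<le> real ?m * ln 2" using elim by (intro mult_right_mono) auto
      ultimately have "u k * real (N k) * ln 2 \<le> - ln (?I (?r k))" by linarith
      then have "u k * real (N k) * ln 2 / - ln (?r k) \<le> - ln (?I (?r k)) / - ln (?r k)"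
        using elim by (intro divide_right_mono) auto
      then show ?case by (simp add: mult_ac)
    qed
  qed
  then show ?thesis unfolding upper_correlation_dim_measure_def .
qed

end

section \<open>Digit sets of prescribed density and targeted sequences\<close>

text \<open>
  The increments of \<open>\<lfloor>\<alpha> * n\<rfloor>\<close> are 0 or 1, and the set collects the positions of the ones.
\<close>

definition floor_density_set :: "real \<Rightarrow> nat set" where
  "floor_density_set \<alpha> = {n. \<lfloor>\<alpha> * real n\<rfloor> < \<lfloor>\<alpha> * real (Suc n)\<rfloor>}"

lemma card_floor_density_set:
  assumes "0 \<le> \<alpha>" "\<alpha> \<le> 1"
  shows "int (card (floor_density_set \<alpha> \<inter> {..<n})) = \<lfloor>\<alpha> * real n\<rfloor>"
proof (induction n)
  case 0
  then show ?case by simp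
next
  case (Suc n)
  have eq: "\<alpha> * real (Suc n) = \<alpha> * real n + \<alpha>" by (simp add: algebra_simps)
  have mono1: "\<lfloor>\<alpha> * real n\<rfloor> \<le> \<lfloor>\<alpha> * real (Suc n)\<rfloor>"
    unfolding eq using assms by (intro floor_mono) simp
  have "\<lfloor>\<alpha> * real (Suc n)\<rfloor> \<le> \<lfloor>\<alpha> * real n + 1\<rfloor>"
    unfolding eq using assms by (intro floor_mono) simp
  then have mono2: "\<lfloor>\<alpha> * real (Suc n)\<rfloor> \<le> \<lfloor>\<alpha> * real n\<rfloor> + 1" by simp
  show ?case
  proof (cases "n \<in> floor_density_set \<alpha>")
    case True
    then have "floor_density_set \<alpha> \<inter> {..<Suc n} = insert n (floor_density_set \<alpha> \<inter> {..<n})"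
      by (auto simp: less_Suc_eq)
    then have "int (card (floor_density_set \<alpha> \<inter> {..<Suc n})) = \<lfloor>\<alpha> * real n\<rfloor> + 1"
      using Suc by simp
    then show ?thesis using mono2 True unfolding floor_density_set_def by simp
  next
    case False
    then have "floor_density_set \<alpha> \<inter> {..<Suc n} = floor_density_set \<alpha> \<inter> {..<n}"
      by (auto simp: less_Suc_eq)
    then show ?thesis using Suc mono1 False unfolding floor_density_set_def by simp
  qed
qed

definition block :: "nat \<Rightarrow> nat set" where
  "block k = {fact (2 * k)..<fact (2 * k + 1)}"

text \<open>
  No block meets \<open>[(2k+1)!, (2k+2)!)\<close>. Because of these long gaps, all digits below \<open>(2k+2)!\<close> are known
  already at the much smaller position \<open>(2k+1)!\<close>.
\<close>

lemma block_below:
  assumes "i \<in> block k'" "i < fact (2 * k + 2)"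
  shows "k' \<le> k" "i < fact (2 * k + 1)"
proof -
  show "k' \<le> k"
  proof (rule ccontr)
    assume "\<not> k' \<le> k"
    then have "(fact (2 * k + 2) :: nat) \<le> fact (2 * k')" by (intro fact_mono) simp
    then show False using assms by (simp add: block_def)
  qed
  then have "(fact (2 * k' + 1) :: nat) \<le> fact (2 * k + 1)" by (intro fact_mono) simp
  then show "i < fact (2 * k + 1)" using assms unfolding block_def by (metis atLeastLessThan_iff less_le_trans)
qed

lemma fact_Suc_ratio: "real (fact m) = 1 / real (m + 1) * real (fact (m + 1))"
  by (simp add: field_simps)

lemma filterlim_fact: 
  assumes "strict_mono g" shows "filterlim (\<lambda>k. fact (g k) :: nat) at_top sequentially"
proof (rule filterlim_at_top_mono[OF filterlim_ident])
  have "k \<le> (fact (g k) :: nat)" for k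
    by (rule order_trans[OF strict_mono_imp_increasing[OF assms] fact_ge_self])
  then show "eventually (\<lambda>k. k \<le> (fact (g k) :: nat)) sequentially" by simp
qed

text \<open>
  An enumeration of the finite sets of naturals (the supports of finite prefixes) in which each one
  occurs infinitely often.
\<close>

definition target :: "nat \<Rightarrow> nat set" where
  "target k = set_decode (fst (prod_decode k))"

lemma target_recurs:
  assumes "finite u"
  shows "\<exists>k\<ge>j. target k = u"
  using assms le_prod_encode_2[of j "set_encode u"]
  by (intro exI[of _ "prod_encode (set_encode u, j)"]) (simp add: target_def)

definition sequences_in :: "nat set \<Rightarrow> (nat \<Rightarrow> bool) set" where
  "sequences_in D = {\<omega>. \<forall>n. \<omega> n \<longrightarrow> n \<in> D}"

definition on_target :: "nat \<Rightarrow> (nat \<Rightarrow> bool) \<Rightarrow> bool" where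
  "on_target k \<omega> \<longleftrightarrow> (\<forall>i<fact (2 * k). \<omega> i \<longleftrightarrow> i \<in> target k)"

text \<open>
  A digit one in block \<open>k\<close> is permitted only after the prefix of length \<open>(2k)!\<close> prescribed by the target.
\<close>

definition targeted_sequences :: "(nat \<Rightarrow> bool) set" where
  "targeted_sequences = {\<omega>. \<forall>n. \<omega> n \<longrightarrow> (\<exists>k. n \<in> block k \<and> on_target k \<omega>)}"

lemma on_target_agree:
  assumes "agree n \<omega> \<omega>'" "fact (2 * k) \<le> n"
  shows "on_target k \<omega> \<longleftrightarrow> on_target k \<omega>'"
  using assms unfolding on_target_def agree_def by (meson less_le_trans)

lemma targeted_sequences_closed:
  assumes "\<omega> \<notin> targeted_sequences"
  shows "\<exists>n. \<forall>\<omega>'. agree n \<omega> \<omega>' \<longrightarrow> \<omega>' \<notin> targeted_sequences"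
proof -
  obtain n where n: "\<omega> n" "\<And>k. n \<in> block k \<Longrightarrow> \<not> on_target k \<omega>"
    using assms by (auto simp: targeted_sequences_def)
  show ?thesis
  proof (intro exI allI impI)
    fix \<omega>' assume ag: "agree (Suc n) \<omega> \<omega>'"
    have "\<omega>' n" using ag n by (auto simp: agree_def)
    moreover have "\<not> on_target k \<omega>'" if "n \<in> block k" for k
      using on_target_agree[OF ag, of k] n(2)[OF that] that by (auto simp: block_def)
    ultimately show "\<omega>' \<notin> targeted_sequences" by (auto simp: targeted_sequences_def)
  qed
qed

text \<open>
  If the target of block \<open>k\<close> is a prefix of an admissible sequence, continued by zeros, then block \<open>k\<close>
  can be filled arbitrarily. The digits below \<open>m\<close> remain admissible since their admissibility refers
  to still earlier digits only.
\<close>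

lemma targeted_sequences_extend:
  assumes \<omega>: "\<omega> \<in> targeted_sequences" and k: "target k = {i. i < m \<and> \<omega> i}" "m \<le> fact (2 * k)"
    and W: "W \<subseteq> block k"
  shows "(\<lambda>i. i \<in> target k \<or> i \<in> W) \<in> targeted_sequences"
  unfolding targeted_sequences_def
proof (intro CollectI allI impI)
  let ?\<eta> = "\<lambda>i. i \<in> target k \<or> i \<in> W"
  have W': "fact (2 * k) \<le> i" if "i \<in> W" for i using W that by (auto simp: block_def)
  fix n assume n: "?\<eta> n"
  show "\<exists>k'. n \<in> block k' \<and> on_target k' ?\<eta>"
  proof (cases "n \<in> W")
    case True
    have "on_target k ?\<eta>" unfolding on_target_def using W' leD by blast
    then show ?thesis using True W by blast
  next
    case False
    then have n: "n < m" "\<omega> n" using n k by auto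
    then obtain k' where k': "n \<in> block k'" "on_target k' \<omega>"
      using \<omega> by (auto simp: targeted_sequences_def)
    have "agree m \<omega> ?\<eta>"
      unfolding agree_def
    proof (intro allI impI)
      fix i assume "i < m"
      then have "i \<notin> W" using W'[of i] k(2) by (meson leD less_le_trans)
      then show "\<omega> i = (i \<in> target k \<or> i \<in> W)" using k(1) \<open>i < m\<close> by simp
    qed
    moreover have "fact (2 * k') \<le> m" using k' n by (auto simp: block_def)
    ultimately have "on_target k' ?\<eta>" using on_target_agree k' by blast
    then show ?thesis using k' by blast
  qed
qed

text \<open>
  Around each point there is a ball of mass below \<open>p\<close>; a Lebesgue number of this cover serves as
  \<open>\<delta>\<close>.
\<close>

lemma nonatomic_small_sets:
  fixes \<mu> :: "'a::euclidean_space measure"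
  assumes \<mu>: "prob_space \<mu>" "sets \<mu> = sets borel" and K: "compact K"
    and na: "\<And>x. x \<in> K \<Longrightarrow> measure \<mu> {x} = 0" and p: "0 < p"
  shows "\<exists>\<delta>>0. \<forall>A\<subseteq>K. diameter A < \<delta> \<longrightarrow> measure \<mu> A < p"
proof -
  interpret prob_space \<mu> by fact
  have "\<exists>s>0. measure \<mu> (ball x s) < p" if x: "x \<in> K" for x
  proof -
    let ?B = "\<lambda>n. ball x (1 / real (Suc n))"
    have "(\<lambda>n. measure \<mu> (?B n)) \<longlonglongrightarrow> measure \<mu> (\<Inter>n. ?B n)"
    proof (rule finite_Lim_measure_decseq[of ?B])
      have "ball x s \<in> sets \<mu>" for s unfolding \<mu>(2) by simp
      then show "range ?B \<subseteq> sets \<mu>" by blast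
      show "decseq ?B"
      proof (rule decseq_SucI)
        fix n
        have "1 / real (Suc (Suc n)) \<le> 1 / real (Suc n)" by (rule frac_le) auto
        then show "?B (Suc n) \<subseteq> ?B n" by (rule subset_ball)
      qed
    qed
    moreover have "(\<Inter>n. ?B n) = {x}"
    proof -
      have "y = x" if "y \<in> (\<Inter>n. ?B n)" for y
      proof (rule ccontr)
        assume "y \<noteq> x"
        then have "0 < dist x y" by simp
        then obtain n where "1 / real (Suc n) < dist x y" by (rule nat_approx_posE)
        moreover have "dist x y < 1 / real (Suc n)" using that by (auto simp: dist_commute)
        ultimately show False by simp
      qed
      moreover have "x \<in> (\<Inter>n. ?B n)" by simp
      ultimately show ?thesis by blast
    qed
    ultimately have "(\<lambda>n. measure \<mu> (?B n)) \<longlonglongrightarrow> 0" using na[OF x] by simp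
    from order_tendstoD(2)[OF this p] obtain n where "measure \<mu> (?B n) < p"
      by (auto simp: eventually_sequentially)
    then show ?thesis by (intro exI[of _ "1 / real (Suc n)"]) simp
  qed
  then have "\<forall>x\<in>K. \<exists>s. 0 < s \<and> measure \<mu> (ball x s) < p" by blast
  from bchoice[OF this] obtain s where s: "\<And>x. x \<in> K \<Longrightarrow> 0 < s x \<and> measure \<mu> (ball x (s x)) < p"
    by blast
  show ?thesis
  proof (cases "K = {}")
    case True
    then show ?thesis using p by (intro exI[of _ 1]) auto
  next
    case False
    let ?C = "(\<lambda>x. ball x (s x)) ` K"
    have "?C \<noteq> {}" "K \<subseteq> \<Union>?C" using False s by auto
    obtain \<delta> where \<delta>: "0 < \<delta>" "\<And>T. T \<subseteq> K \<Longrightarrow> diameter T < \<delta> \<Longrightarrow> \<exists>B\<in>?C. T \<subseteq> B"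
    proof (rule Lebesgue_number_lemma[OF K \<open>?C \<noteq> {}\<close> \<open>K \<subseteq> \<Union>?C\<close>])
      show "open B" if "B \<in> ?C" for B using that by auto
    qed blast
    have "measure \<mu> A < p" if A: "A \<subseteq> K" "diameter A < \<delta>" for A
    proof -
      obtain x where x: "x \<in> K" "A \<subseteq> ball x (s x)" using \<delta>(2)[OF A] by auto
      then have "measure \<mu> A \<le> measure \<mu> (ball x (s x))" using \<mu> by (intro finite_measure_mono) auto
      then show ?thesis using s[OF x(1)] by simp
    qed
    then show ?thesis using \<delta>(1) by blast
  qed
qed

text \<open>
  The covers that define the packing measure consist of arbitrary sets, so Baire's theorem, applied to
  their closures, yields density in a relatively open part only. This is enough for packings, whose
  centres can be moved slightly.
\<close>

lemma Baire_countable_cover: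
  fixes K :: "'a::euclidean_space set" and F :: "nat \<Rightarrow> 'a set"
  assumes "closed K" "K \<noteq> {}" "K \<subseteq> (\<Union>i. F i)"
  shows "\<exists>i. \<exists>x\<in>K. \<exists>\<epsilon>>0. ball x \<epsilon> \<inter> K \<subseteq> closure (F i)"
proof (rule ccontr)
  assume neg: "\<not> ?thesis"
  let ?G = "\<lambda>i. K - closure (F i)"
  have "K \<subseteq> closure (\<Inter>(range ?G))"
  proof (rule Baire[OF assms(1)])
    fix T assume "T \<in> range ?G"
    then obtain i where T: "T = ?G i" by auto
    have "openin (top_of_set K) (K \<inter> - closure (F i))" by (intro openin_open_Int open_Compl closed_closure)
    moreover have "K \<subseteq> closure (?G i)"
      unfolding subset_iff closure_approachable
    proof (intro allI impI)
      fix x \<epsilon> assume "x \<in> K" "0 < (\<epsilon> :: real)"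
      then have "\<not> ball x \<epsilon> \<inter> K \<subseteq> closure (F i)" using neg by blast
      then show "\<exists>y\<in>?G i. dist y x < \<epsilon>" by (auto simp: dist_commute)
    qed
    ultimately show "openin (top_of_set K) T \<and> K \<subseteq> closure T" unfolding T by (simp add: Diff_eq)
  qed simp
  moreover have "\<Inter>(range ?G) = {}"
  proof (rule equals0I)
    fix x assume x: "x \<in> \<Inter>(range ?G)"
    then obtain i where "x \<in> F i" using assms(3) by blast
    then have "x \<in> closure (F i)" using closure_subset by blast
    then show False using x by blast
  qed
  ultimately have "K \<subseteq> closure {}" by (simp only:)
  then show False using assms(2) by simp
qed

section \<open>Dimensions of the pieces\<close>

context binary_cantor
begin

lemma compact_sequences_in: "compact (point ` sequences_in D)"
proof (rule compact_point_image)
  fix \<omega> assume "\<omega> \<notin> sequences_in D"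
  then obtain n where "\<omega> n" "n \<notin> D" by (auto simp: sequences_in_def)
  then show "\<exists>n. \<forall>\<omega>'. agree n \<omega> \<omega>' \<longrightarrow> \<omega>' \<notin> sequences_in D"
    by (intro exI[of _ "Suc n"]) (auto simp: sequences_in_def agree_def)
qed

lemma compact_targeted: "compact (point ` targeted_sequences)"
  by (rule compact_point_image) (rule targeted_sequences_closed)

lemma compact_targeted_hit: "compact (point ` {\<omega> \<in> targeted_sequences. on_target k \<omega>})"
proof (rule compact_point_image)
  fix \<omega> assume "\<omega> \<notin> {\<omega> \<in> targeted_sequences. on_target k \<omega>}"
  then consider "\<omega> \<notin> targeted_sequences" | "\<not> on_target k \<omega>" by auto
  then show "\<exists>n. \<forall>\<omega>'. agree n \<omega> \<omega>' \<longrightarrow> \<omega>' \<notin> {\<omega> \<in> targeted_sequences. on_target k \<omega>}"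
  proof cases
    case 1
    then show ?thesis using targeted_sequences_closed by blast
  next
    case 2
    then show ?thesis using on_target_agree[of "fact (2 * k)" \<omega> _ k] by blast
  qed
qed

lemma diameter_point_image_le:
  assumes "\<And>\<omega> \<omega>'. \<omega> \<in> T \<Longrightarrow> \<omega>' \<in> T \<Longrightarrow> agree n \<omega> \<omega>'"
  shows "diameter (point ` T) \<le> diam_const * rho ^ n"
  by (rule diameter_le) (use assms dist_point_le diam_const_pos rho in \<open>auto simp: dist_norm\<close>)

text \<open>
  At level \<open>(2k+2)!\<close> only the digits below \<open>(2k+1)!\<close> can differ from zero, a fraction \<open>1 / (2k+2)\<close>.
\<close>

lemma lower_box_dim_blocks_le:
  assumes "\<And>\<omega> i. \<omega> \<in> T \<Longrightarrow> \<omega> i \<Longrightarrow> i \<in> (\<Union>k. block k)"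
  shows "lower_box_dim (point ` T) \<le> 0"
proof -
  have "lower_box_dim (point ` T) \<le> ereal (c * 0)"
  proof (rule lower_box_dim_point_image_le)
    show "filterlim (\<lambda>k. fact (2 * k + 2) :: nat) at_top sequentially"
      by (rule filterlim_fact) (auto simp: strict_mono_def)
    show "finite {..<fact (2 * k + 1) :: nat}" for k by simp
    show "i \<in> {..<fact (2 * k + 1)}" if "\<omega> \<in> T" "i < fact (2 * k + 2)" "\<omega> i" for k \<omega> i
      using block_below(2)[of i _ k] assms[OF that(1,3)] that(2) by auto
    show "eventually (\<lambda>k. real (card {..<fact (2 * k + 1) :: nat}) \<le> 1 / real (2 * k + 2) * real (fact (2 * k + 2))) sequentially"
      using fact_Suc_ratio[of "2 * k + 1" for k] by (intro always_eventually) simp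
    have "(\<lambda>n. 1 / real (n + 2)) \<longlonglongrightarrow> 0" by (rule LIMSEQ_ignore_initial_segment[OF lim_1_over_n])
    then show "(\<lambda>k. 1 / real (2 * k + 2)) \<longlonglongrightarrow> 0"
      by (rule filterlim_compose) (rule filterlim_subseq, simp add: strict_mono_def)
  qed
  then show ?thesis by (simp add: zero_ereal_def)
qed

lemma lower_box_dim_sequences_in_le:
  assumes "\<And>n. real (card (D \<inter> {..<n})) \<le> \<alpha> * real n"
  shows "lower_box_dim (point ` sequences_in D) \<le> ereal (c * \<alpha>)"
proof (rule lower_box_dim_point_image_le)
  show "filterlim (\<lambda>n. n) at_top sequentially" by (rule filterlim_ident)
  show "(\<lambda>_. \<alpha>) \<longlonglongrightarrow> \<alpha>" by simp
  show "i \<in> D \<inter> {..<n}" if "\<omega> \<in> sequences_in D" "i < n" "\<omega> i" for \<omega> i n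
    using that by (auto simp: sequences_in_def)
qed (use assms in auto)

text \<open>
  Some member of a countable cover has positive coin measure.
\<close>

lemma modified_lower_box_dim_ge:
  assumes E: "E \<in> sets borel" "point ` sequences_in D \<subseteq> E"
    and D: "\<And>n. \<alpha> * real n - 1 \<le> real (card (D \<inter> {..<n}))"
  shows "ereal (c * \<alpha>) \<le> modified_lower_box_dim E"
  unfolding modified_lower_box_dim_def
proof (rule INF_greatest)
  fix F :: "nat \<Rightarrow> 'a set"
  assume "F \<in> {F. (\<forall>i. F i \<noteq> {} \<and> compact (F i)) \<and> E \<subseteq> (\<Union>i. F i)}"
  then have F: "\<And>i. compact (F i)" "E \<subseteq> (\<Union>i. F i)" by auto
  interpret prob_space "coin_measure D" by (rule prob_space_coin_measure)
  have "coin_measure D \<in> borel_prob_measures_on E"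
    using E by (intro coin_measure_in_borel_prob_measures_on) (auto simp: sequences_in_def)
  then have null: "emeasure (coin_measure D) (UNIV - E) = 0" by (simp add: borel_prob_measures_on_def)
  have sp: "space (coin_measure D) = UNIV" by (simp add: coin_measure_def)
  have Fs: "F i \<in> sets (coin_measure D)" for i using F(1) by (simp add: borel_compact)
  have "\<exists>i. emeasure (coin_measure D) (F i) \<noteq> 0"
  proof (rule ccontr)
    assume "\<not> ?thesis"
    then have "emeasure (coin_measure D) (\<Union>i. F i) = 0" using Fs by (intro emeasure_UN_eq_0) auto
    then have "emeasure (coin_measure D) ((\<Union>i. F i) \<union> (UNIV - E)) = 0"
      using Fs E null by (subst emeasure_Un_null_set) (auto intro!: null_setsI)
    moreover have "(\<Union>i. F i) \<union> (UNIV - E) = space (coin_measure D)" using F(2) sp by auto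
    ultimately show False using emeasure_space_1 by simp
  qed
  then obtain i where "0 < measure (coin_measure D) (F i)"
    by (auto simp: emeasure_eq_measure zero_less_measure_iff)
  then have "ereal (c * \<alpha>) \<le> lower_box_dim (F i)" using F D by (intro lower_box_dim_ge)
  also have "\<dots> \<le> (SUP i. lower_box_dim (F i))" by (rule SUP_upper) simp
  finally show "ereal (c * \<alpha>) \<le> (SUP i. lower_box_dim (F i))" .
qed

lemma correlation_dim_sequences_in_le:
  assumes \<mu>: "prob_space \<mu>" "sets \<mu> = sets borel"
    and pos: "0 < measure \<mu> (point ` sequences_in D)"
    and D: "\<And>n. real (card (D \<inter> {..<n})) \<le> \<beta> * real n"
  shows "upper_correlation_dim_measure \<mu> \<le> ereal (c * \<beta>)"
proof (rule upper_correlation_dim_measure_le[OF \<mu> pos], rule always_eventually, rule allI)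
  fix n
  have "covered_by_balls (2 ^ card (D \<inter> {..<n})) (diam_const * rho ^ n) (point ` sequences_in D)"
    by (rule covered_point_image) (auto simp: sequences_in_def)
  then show "\<exists>A\<in>sets borel. measure \<mu> (point ` sequences_in D) \<le> measure \<mu> A \<and>
      (\<exists>j. real j \<le> \<beta> * real n \<and> covered_by_balls (2 ^ j) (diam_const * rho ^ n) A)"
    using D[of n] borel_compact[OF compact_sequences_in] by blast
qed

text \<open>
  If \<open>\<mu>\<close> has an atom, take it for \<open>A\<close>. Otherwise, for a level \<open>n\<close> between \<open>(2m)!\<close> and \<open>(2m+2)!\<close>, only the
  sequences on target \<open>m\<close> have free digits in block \<open>m\<close>. They form a set of diameter of order
  \<open>rho ^ (2m)!\<close>, which has small mass, and are removed. What remains is determined up to level \<open>n\<close> by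
  the digits below \<open>(2m-1)!\<close>, at most a fraction \<open>1 / (2m)\<close> of \<open>n\<close>.
\<close>

lemma correlation_dim_targeted_le:
  assumes \<mu>: "prob_space \<mu>" "sets \<mu> = sets borel"
    and pos: "0 < measure \<mu> (point ` targeted_sequences)" and \<beta>: "0 < \<beta>"
  shows "upper_correlation_dim_measure \<mu> \<le> ereal (c * \<beta>)"
proof (cases "\<exists>x. 0 < measure \<mu> {x}")
  case True
  then obtain x where x: "0 < measure \<mu> {x}" by blast
  show ?thesis
  proof (rule upper_correlation_dim_measure_le[OF \<mu> x], rule always_eventually, rule allI)
    fix n
    have "covered_by_balls (2 ^ 0) (diam_const * rho ^ n) {x}"
      unfolding covered_by_balls_def using diam_const_pos rho by (intro exI[of _ "{x}"]) auto
    then show "\<exists>A\<in>sets borel. measure \<mu> {x} \<le> measure \<mu> A \<and>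
        (\<exists>j. real j \<le> \<beta> * real n \<and> covered_by_balls (2 ^ j) (diam_const * rho ^ n) A)"
      using \<beta> by (intro bexI[of _ "{x}"] conjI exI[of _ "0::nat"]) auto
  qed
next
  case False
  interpret prob_space \<mu> by fact
  let ?K = "point ` targeted_sequences"
  let ?hit = "\<lambda>k. point ` {\<omega> \<in> targeted_sequences. on_target k \<omega>}"
  define p where "p = measure \<mu> ?K / 2"
  have p: "0 < p" using pos by (simp add: p_def)
  have na: "measure \<mu> {x} = 0" for x using False measure_nonneg[of \<mu> "{x}"] by (metis less_eq_real_def)
  obtain \<delta> where \<delta>: "0 < \<delta>" "\<And>A. A \<subseteq> ?K \<Longrightarrow> diameter A < \<delta> \<Longrightarrow> measure \<mu> A < p"
    using nonatomic_small_sets[OF \<mu> compact_targeted na p] by metis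
  have "(\<lambda>k. diam_const * rho ^ fact (2 * k)) \<longlonglongrightarrow> 0"
    using filterlim_scale[OF diam_const_pos filterlim_fact, of "\<lambda>k. 2 * k"]
    by (simp add: strict_mono_def filterlim_at)
  then have "eventually (\<lambda>k. diam_const * rho ^ fact (2 * k) < \<delta>) sequentially"
    using \<delta>(1) by (rule order_tendstoD)
  moreover have "(\<lambda>k. 1 / real (2 * k)) \<longlonglongrightarrow> 0"
    by (rule filterlim_compose[OF lim_1_over_n]) (rule filterlim_subseq, simp add: strict_mono_def)
  then have "eventually (\<lambda>k. 1 / real (2 * k) < \<beta>) sequentially"
    using \<beta> by (rule order_tendstoD)
  ultimately have "eventually (\<lambda>k. diam_const * rho ^ fact (2 * k) < \<delta> \<and> 1 / real (2 * k) < \<beta>) sequentially"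
    by eventually_elim simp
  then obtain k0 where k0: "\<And>k. k0 \<le> k \<Longrightarrow> diam_const * rho ^ fact (2 * k) < \<delta> \<and> 1 / real (2 * k) < \<beta>"
    by (auto simp: eventually_sequentially)
  show ?thesis
  proof (rule upper_correlation_dim_measure_le[OF \<mu> p])
    show "eventually (\<lambda>n. \<exists>A\<in>sets borel. p \<le> measure \<mu> A \<and>
        (\<exists>j. real j \<le> \<beta> * real n \<and> covered_by_balls (2 ^ j) (diam_const * rho ^ n) A)) sequentially"
      using eventually_ge_at_top[of "fact (2 * k0 + 2)"]
    proof eventually_elim
      case (elim n)
      \<comment> \<open>the last block that begins at or before \<open>n\<close>\<close>
      define m where "m = (LEAST k. n < fact (2 * k + 2))"
      have "n < fact (2 * n + 2)" using fact_ge_self[of "2 * n + 2"] by linarith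
      then have m1: "n < fact (2 * m + 2)" unfolding m_def by (rule LeastI)
      have "k0 < m"
      proof (rule ccontr)
        assume "\<not> k0 < m"
        then have "(fact (2 * m + 2) :: nat) \<le> fact (2 * k0 + 2)" by (intro fact_mono) simp
        then show False using m1 elim by simp
      qed
      then obtain l where l: "m = Suc l" "k0 \<le> l" by (cases m) auto
      have "\<not> n < fact (2 * l + 2)"
        using not_less_Least[of l "\<lambda>k. n < fact (2 * k + 2)"] l unfolding m_def by simp
      then have m2: "fact (2 * m) \<le> n" using l by simp
      have mk: "diam_const * rho ^ fact (2 * m) < \<delta>" "1 / real (2 * m) < \<beta>" using k0[of m] l by auto
      have "diameter (?hit m) \<le> diam_const * rho ^ fact (2 * m)"
        by (rule diameter_point_image_le) (auto simp: on_target_def agree_def)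
      then have hit: "measure \<mu> (?hit m) < p" using mk by (intro \<delta>(2)) auto
      have sets: "?hit m \<in> sets \<mu>" "?K \<in> sets \<mu>"
        using \<mu> by (simp_all add: borel_compact compact_targeted compact_targeted_hit)
      let ?A = "?K - ?hit m"
      have "measure \<mu> ?A = measure \<mu> ?K - measure \<mu> (?hit m)"
        using sets by (intro finite_measure_Diff) auto
      then have A: "p \<le> measure \<mu> ?A" using hit by (simp add: p_def)
      let ?T = "{\<omega> \<in> targeted_sequences. \<not> on_target m \<omega>}"
      have "covered_by_balls (2 ^ card {..<fact (2 * l + 1) :: nat}) (diam_const * rho ^ n) (point ` ?T)"
      proof (rule covered_point_image)
        fix \<omega> i assume \<omega>: "\<omega> \<in> ?T" "i < n" "\<omega> i"
        then obtain k where k: "i \<in> block k" "on_target k \<omega>" by (auto simp: targeted_sequences_def)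
        then have "k \<le> m" "k \<noteq> m" using block_below(1)[of i k m] \<omega> m1 by auto
        then have "(fact (2 * k + 1) :: nat) \<le> fact (2 * l + 1)" using l by (intro fact_mono) simp
        then show "i \<in> {..<fact (2 * l + 1)}" using k by (auto simp: block_def)
      qed auto
      then have "covered_by_balls (2 ^ fact (2 * l + 1)) (diam_const * rho ^ n) ?A"
        by (rule covered_by_balls_mono) auto
      moreover have "real (fact (2 * l + 1)) \<le> \<beta> * real n"
      proof -
        have "real (fact (2 * l + 1)) = 1 / real (2 * m) * real (fact (2 * m))"
          using fact_Suc_ratio[of "2 * l + 1"] l by simp
        also have "\<dots> \<le> \<beta> * real n"
          using mk of_nat_mono[OF m2, where 'a = real] \<beta> by (intro mult_mono) auto
        finally show ?thesis .
      qed
      ultimately show ?case using A sets \<mu>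
        by (intro bexI[of _ ?A] conjI exI[of _ "fact (2 * l + 1)"]) auto
    qed
  qed
qed

text \<open>
  The \<open>c\<close>-th powers of the diameters of disjoint balls centred in the Cantor set are bounded by the
  masses of the balls up to a constant, so their sum is bounded. For \<open>s > c\<close> this leaves a
  factor \<open>\<delta> powr (s - c)\<close>.
\<close>

lemma packing_dim_le:
  assumes "E \<subseteq> range point"
  shows "packing_dim E \<le> ereal c"
proof -
  interpret prob_space "coin_measure UNIV" by (rule prob_space_coin_measure)
  let ?\<nu> = "coin_measure UNIV"
  define K where "K = 2 * (2 * diam_const) powr c"
  have ball: "(2 * r) powr c \<le> K * measure ?\<nu> (cball x r)"
    if r: "0 < r" "r < diam_const" and x: "x \<in> E" for r x
  proof -
    obtain \<omega> where \<omega>: "x = point \<omega>" using x assms by auto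
    have "\<not> level diam_const r \<le> 0" using level_le_iff[OF diam_const_pos r(1), of 0] r by simp
    then obtain n where n: "level diam_const r = Suc n" by (cases "level diam_const r") auto
    then have "\<not> level diam_const r \<le> n" by simp
    then have "r < diam_const * rho ^ n" using level_le_iff[OF diam_const_pos r(1)] by simp
    then have "(2 * r) powr c \<le> (2 * diam_const * rho ^ n) powr c"
      using r c by (intro powr_mono2) auto
    also have "\<dots> = (2 * diam_const) powr c * (rho powr c) ^ n"
      using diam_const_pos rho c
      by (simp add: powr_mult powr_realpow[symmetric] powr_powr mult_ac)
    also have "rho powr c = 1 / 2"
      unfolding rho_def powr_powr using c by (simp add: powr_minus_divide)
    also have "(2 * diam_const) powr c * (1 / 2) ^ n = K * (1 / 2) ^ Suc n" by (simp add: K_def)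
    also have "\<dots> \<le> K * measure ?\<nu> (cball x r)"
      using coin_measure_UNIV_cball_ge[OF r(1), of \<omega>] n \<omega> by (intro mult_left_mono) (auto simp: K_def)
    finally show ?thesis .
  qed
  have sup: "packing_sup s \<delta> E \<le> ennreal ((2 * \<delta>) powr (s - c) * K)"
    if s: "c < s" and \<delta>: "0 < \<delta>" "\<delta> < diam_const" for s \<delta>
    unfolding packing_sup_def
  proof (rule SUP_least)
    fix \<B> :: "'a set set" assume "\<B> \<in> {\<B>. is_packing \<delta> E \<B>}"
    then have \<B>: "disjoint \<B>" "\<And>B. B \<in> \<B> \<Longrightarrow> \<exists>x\<in>E. \<exists>r. 0 < r \<and> r \<le> \<delta> \<and> B = cball x r"
      by (auto simp: is_packing_def)
    show "(\<Sum>\<^sub>\<infinity>B\<in>\<B>. ennreal (diameter B powr s)) \<le> ennreal ((2 * \<delta>) powr (s - c) * K)"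
    proof (rule infsum_le_finite_sums)
      fix F assume F: "finite F" "F \<subseteq> \<B>"
      have le_mass: "diameter B powr s \<le> (2 * \<delta>) powr (s - c) * K * measure ?\<nu> B"
        and meas: "B \<in> sets ?\<nu>" if "B \<in> F" for B
      proof -
        have "B \<in> \<B>" using that F by auto
        from \<B>(2)[OF this]
        obtain x r where B: "x \<in> E" "0 < r" "r \<le> \<delta>" "B = cball x r" by blast
        then show "B \<in> sets ?\<nu>" by simp
        have "diameter B powr s = (2 * r) powr (s - c) * (2 * r) powr c"
          using B by (simp add: powr_add[symmetric])
        also have "\<dots> \<le> (2 * \<delta>) powr (s - c) * (K * measure ?\<nu> (cball x r))"
          using B s \<delta> by (intro mult_mono powr_mono2 ball) auto
        finally show "diameter B powr s \<le> (2 * \<delta>) powr (s - c) * K * measure ?\<nu> B"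
          using B by (simp add: mult.assoc)
      qed
      have "(\<Sum>B\<in>F. diameter B powr s) \<le> (2 * \<delta>) powr (s - c) * K * (\<Sum>B\<in>F. measure ?\<nu> B)"
        unfolding sum_distrib_left by (rule sum_mono) (rule le_mass)
      also have "(\<Sum>B\<in>F. measure ?\<nu> B) = measure ?\<nu> (\<Union>B\<in>F. B)"
        using F \<B>(1) meas by (intro finite_measure_finite_Union[symmetric])
          (auto simp: disjoint_family_on_def disjoint_def)
      also have "(2 * \<delta>) powr (s - c) * K * \<dots> \<le> (2 * \<delta>) powr (s - c) * K * 1"
        by (intro mult_left_mono prob_le_1) (auto simp: K_def)
      finally have "(\<Sum>B\<in>F. diameter B powr s) \<le> (2 * \<delta>) powr (s - c) * K" by simp
      then show "(\<Sum>B\<in>F. ennreal (diameter B powr s)) \<le> ennreal ((2 * \<delta>) powr (s - c) * K)"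
        by (subst sum_ennreal) (auto intro: ennreal_leI)
    qed (rule nonneg_summable_on_complete, rule zero_le)
  qed
  have zero: "packing_measure s E = 0" if s: "c < s" for s
  proof -
    have pre: "packing_premeasure s E \<le> ennreal ((2 * \<delta>) powr (s - c) * K)"
      if "\<delta> \<in> {0<..<diam_const}" for \<delta>
      unfolding packing_premeasure_def using sup[OF s] that by (intro INF_lower2[of \<delta>]) auto
    have "eventually (\<lambda>\<delta>::real. 0 \<le> \<delta>) (at_right 0)"
      using eventually_at_right_less[of "0::real"] by (rule eventually_mono) simp
    then have "((\<lambda>\<delta>. (2 * \<delta>) powr (s - c) * K) \<longlongrightarrow> (2 * 0) powr (s - c) * K) (at_right 0)"
      using s by (intro tendsto_intros tendsto_powr') auto
    then have "((\<lambda>\<delta>. ennreal ((2 * \<delta>) powr (s - c) * K)) \<longlongrightarrow> ennreal 0) (at_right 0)"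
      by (intro tendsto_ennrealI) simp
    moreover have "eventually (\<lambda>\<delta>. packing_premeasure s E \<le> ennreal ((2 * \<delta>) powr (s - c) * K)) (at_right 0)"
      using eventually_at_right_real[OF diam_const_pos] by eventually_elim (rule pre)
    ultimately have "packing_premeasure s E \<le> ennreal 0"
      by (rule tendsto_lowerbound) simp
    then have "packing_premeasure s E = 0" by simp
    moreover have "packing_measure s E \<le> (\<Sum>i::nat. packing_premeasure s E)"
      unfolding packing_measure_def by (rule INF_lower2[of "\<lambda>_. E"]) auto
    ultimately show ?thesis by simp
  qed
  show ?thesis
  proof (rule ereal_le_epsilon2)
    fix \<epsilon> :: real assume "0 < \<epsilon>"
    then have "packing_dim E \<le> ereal (c + \<epsilon>)"
      unfolding packing_dim_def using zero[of "c + \<epsilon>"] c by (intro INF_lower) auto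
    then show "packing_dim E \<le> ereal c + ereal \<epsilon>" by simp
  qed
qed

text \<open>
  Choose a block \<open>k\<close>, as late as necessary, whose target is a prefix of the sequence of \<open>x\<close> so long
  that everything with this prefix lies in the ball. The \<open>2 ^ card (block k)\<close> ways to fill the block give
  points at mutual distance at least \<open>gap_const * rho ^ (2k+1)!\<close>. They lie in the closure of \<open>F\<close>
  only, hence are moved into \<open>F\<close> by less than a quarter of this distance; balls with a fifth of it as
  radius stay disjoint. Since \<open>(2k)!\<close> is negligible against \<open>(2k+1)!\<close>, the \<open>s\<close>-th powers of the diameters sum to at
  least \<open>1\<close> for \<open>s < c\<close>.
\<close>

lemma packing_sup_ge:
  assumes s: "0 \<le> s" "s < c" and \<delta>: "0 < \<delta>"
    and x: "x \<in> point ` targeted_sequences" "0 < \<epsilon>" "ball x \<epsilon> \<inter> point ` targeted_sequences \<subseteq> closure F"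
  shows "1 \<le> packing_sup s \<delta> F"
proof -
  obtain \<omega> where \<omega>: "\<omega> \<in> targeted_sequences" "x = point \<omega>" using x by auto
  define m where "m = level diam_const (\<epsilon> / 2)"
  define u where "u = {i. i < m \<and> \<omega> i}"
  have u: "finite u" by (simp add: u_def)
  let ?q = "\<lambda>k. fact (2 * k + 1) :: nat"
  let ?\<eta> = "\<lambda>k. gap_const * rho ^ ?q k"
  \<comment> \<open>half of the exponential gain per digit: the other half absorbs the digits below \<open>(2k)!\<close>\<close>
  define \<theta> where "\<theta> = (1 - s / c) / 2"
  have \<theta>: "0 < \<theta>" using s c by (simp add: \<theta>_def)
  have fl: "filterlim ?q at_top sequentially" by (rule filterlim_fact) (simp add: strict_mono_def)
  have ev1: "eventually (\<lambda>k. ?\<eta> k < \<delta>) sequentially"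
    using filterlim_scale[OF gap_const_pos fl] \<delta> by (intro order_tendstoD) (auto simp: filterlim_at)
  have "(\<lambda>n. 1 / real (n + 1)) \<longlonglongrightarrow> 0" by (rule LIMSEQ_ignore_initial_segment[OF lim_1_over_n])
  then have "(\<lambda>k. 1 / real (2 * k + 1)) \<longlonglongrightarrow> 0"
    by (rule filterlim_compose) (rule filterlim_subseq, simp add: strict_mono_def)
  then have ev2: "eventually (\<lambda>k. 1 / real (2 * k + 1) < \<theta>) sequentially"
    using \<theta> by (rule order_tendstoD)
  let ?L = "- s * ln (2 * gap_const / 5)"
  \<comment> \<open>from here on the gain outweighs the constant factor \<open>(2 * gap_const / 5) powr s\<close>\<close>
  have ev3: "eventually (\<lambda>k. nat \<lceil>?L / (\<theta> * ln 2)\<rceil> \<le> ?q k) sequentially"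
    using fl unfolding filterlim_at_top by blast
  from ev1 ev2 ev3 eventually_ge_at_top[of m]
  have "eventually (\<lambda>k. ?\<eta> k < \<delta> \<and> 1 / real (2 * k + 1) < \<theta> \<and> nat \<lceil>?L / (\<theta> * ln 2)\<rceil> \<le> ?q k \<and> m \<le> k) sequentially"
    by eventually_elim simp
  then obtain k0 where k0: "\<And>k. k0 \<le> k \<Longrightarrow> ?\<eta> k < \<delta> \<and> 1 / real (2 * k + 1) < \<theta> \<and> nat \<lceil>?L / (\<theta> * ln 2)\<rceil> \<le> ?q k \<and> m \<le> k"
    by (auto simp: eventually_sequentially)
  obtain k where k: "k0 \<le> k" "target k = u" using target_recurs[OF u] by blast
  define \<eta> where "\<eta> = ?\<eta> k"
  have \<eta>: "0 < \<eta>" "\<eta> < \<delta>" using k0[OF k(1)] gap_const_pos rho by (auto simp: \<eta>_def)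
  have "m \<le> k" using k0[OF k(1)] by simp
  also have "k \<le> fact (2 * k)" using fact_ge_self[of "2 * k"] by linarith
  finally have mk: "m \<le> fact (2 * k)" .
  define y where "y W = point (\<lambda>i. i \<in> target k \<or> i \<in> W)" for W
  have y: "y W \<in> closure F" if W: "W \<subseteq> block k" for W
  proof -
    have "(\<lambda>i. i \<in> target k \<or> i \<in> W) \<in> targeted_sequences"
      using \<omega>(1) k(2) mk W by (intro targeted_sequences_extend) (auto simp: u_def)
    moreover have "agree m \<omega> (\<lambda>i. i \<in> target k \<or> i \<in> W)"
      using W mk unfolding agree_def k(2) u_def block_def by force
    then have "dist x (y W) \<le> \<epsilon> / 2"
      unfolding y_def \<omega>(2) m_def using x(2) by (intro agree_level_imp_dist_le) auto
    then have "y W \<in> ball x \<epsilon>" using x(2) by simp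
    ultimately show ?thesis using x(3) unfolding y_def by blast
  qed
  have y_sep: "\<eta> \<le> dist (y W) (y W')" if W: "W \<subseteq> block k" "W' \<subseteq> block k" "W \<noteq> W'" for W W'
  proof -
    obtain i where i: "(i \<in> W) \<noteq> (i \<in> W')" using W(3) by blast
    then have "i \<in> block k" using W by auto
    then have i': "fact (2 * k) \<le> i" "i < ?q k" by (auto simp: block_def)
    have "i \<notin> target k" using i'(1) k(2) mk by (auto simp: u_def)
    moreover have "i < Suc (?q k)" using i'(2) by (rule less_SucI)
    ultimately have "\<not> agree (Suc (?q k)) (\<lambda>i. i \<in> target k \<or> i \<in> W) (\<lambda>i. i \<in> target k \<or> i \<in> W')"
      using i unfolding agree_def by blast
    then show ?thesis unfolding \<eta>_def y_def by (rule dist_point_ge)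
  qed
  have "\<exists>z\<in>F. dist z (y W) < \<eta> / 4" if "W \<subseteq> block k" for W
    using y[OF that, unfolded closure_approachable, rule_format, of "\<eta> / 4"] \<eta> by simp
  then obtain z where z: "\<And>W. W \<subseteq> block k \<Longrightarrow> z W \<in> F \<and> dist (z W) (y W) < \<eta> / 4" by metis
  have z_sep: "\<eta> / 2 < dist (z W) (z W')" if W: "W \<subseteq> block k" "W' \<subseteq> block k" "W \<noteq> W'" for W W'
  proof -
    have "dist (y W) (y W') \<le> dist (z W) (y W) + dist (z W) (z W') + dist (z W') (y W')"
      using dist_triangle[of "y W" "y W'" "z W"] dist_triangle[of "z W" "y W'" "z W'"]
      by (simp add: dist_commute)
    then show ?thesis using y_sep[OF W] z[OF W(1)] z[OF W(2)] by linarith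
  qed
  let ?b = "\<lambda>W. cball (z W) (\<eta> / 5)"
  have disj: "?b W \<inter> ?b W' = {}" if "W \<subseteq> block k" "W' \<subseteq> block k" "W \<noteq> W'" for W W'
  proof (rule ccontr)
    assume "?b W \<inter> ?b W' \<noteq> {}"
    then obtain v where v: "dist (z W) v \<le> \<eta> / 5" "dist (z W') v \<le> \<eta> / 5" by auto
    have "dist (z W) (z W') \<le> dist (z W) v + dist (z W') v" by (rule dist_triangle2)
    then show False using z_sep[OF that] v \<eta> by linarith
  qed
  have ne: "?b W \<noteq> {}" for W using \<eta> by simp
  have inj: "inj_on ?b (Pow (block k))"
  proof (rule inj_onI, rule ccontr)
    fix W W' assume "W \<in> Pow (block k)" "W' \<in> Pow (block k)" "?b W = ?b W'" "W \<noteq> W'"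
    then show False using disj[of W W'] ne[of W] by (auto simp del: cball_eq_cball_iff)
  qed
  let ?B = "?b ` Pow (block k)"
  have fin: "finite (block k)" by (simp add: block_def)
  have "is_packing \<delta> F ?B"
    unfolding is_packing_def
  proof (intro conjI ballI)
    show "countable ?B" using fin by (intro countable_finite) simp
    show "disjoint ?B"
      unfolding disjoint_def
    proof (intro ballI impI)
      fix A A' assume "A \<in> ?B" "A' \<in> ?B" "A \<noteq> A'"
      then obtain W W' where "W \<subseteq> block k" "W' \<subseteq> block k" "A = ?b W" "A' = ?b W'" "W \<noteq> W'" by blast
      then show "A \<inter> A' = {}" using disj by simp
    qed
    fix A assume "A \<in> ?B"
    then obtain W where W: "W \<subseteq> block k" "A = ?b W" by blast
    show "\<exists>x\<in>F. \<exists>r. 0 < r \<and> r \<le> \<delta> \<and> A = cball x r"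
      using z[OF W(1)] W \<eta> by (intro bexI[of _ "z W"] exI[of _ "\<eta> / 5"]) auto
  qed
  then have "(\<Sum>\<^sub>\<infinity>B\<in>?B. ennreal (diameter B powr s)) \<le> packing_sup s \<delta> F"
    unfolding packing_sup_def by (intro SUP_upper) simp
  also have "(\<Sum>\<^sub>\<infinity>B\<in>?B. ennreal (diameter B powr s)) = (\<Sum>B\<in>?B. ennreal (diameter B powr s))"
    using fin by (intro infsum_finite) simp
  also have "\<dots> = (\<Sum>W\<in>Pow (block k). ennreal ((2 * \<eta> / 5) powr s))"
    using \<eta> by (subst sum.reindex[OF inj]) simp
  also have "\<dots> = ennreal (2 ^ card (block k) * (2 * \<eta> / 5) powr s)"
    using fin by (simp add: card_Pow ennreal_mult'' ennreal_of_nat_eq_real_of_nat)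
  finally have le: "ennreal (2 ^ card (block k) * (2 * \<eta> / 5) powr s) \<le> packing_sup s \<delta> F" .
  have "1 \<le> 2 ^ card (block k) * (2 * \<eta> / 5) powr s"
  proof -
    let ?Q = "real (?q k)"
    have Q: "real (fact (2 * k)) \<le> \<theta> * ?Q"
    proof -
      have "real (fact (2 * k)) = 1 / real (2 * k + 1) * ?Q" using fact_Suc_ratio[of "2 * k"] by simp
      also have "\<dots> \<le> \<theta> * ?Q" using k0[OF k(1)] by (intro mult_right_mono) auto
      finally show ?thesis .
    qed
    have "(fact (2 * k) :: nat) \<le> ?q k" by (rule fact_mono) simp
    then have card: "real (card (block k)) = ?Q - real (fact (2 * k))" by (simp add: block_def of_nat_diff)
    have "2 * \<eta> / 5 = (2 * gap_const / 5) * rho ^ ?q k" by (simp add: \<eta>_def)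
    then have ln\<eta>: "ln (2 * \<eta> / 5) = ln (2 * gap_const / 5) - ?Q * ln 2 / c"
      using gap_const_pos rho by (simp only:) (subst ln_mult, auto simp: ln_realpow ln_rho)
    have distrib: "(1 - s / c - \<theta>) * x * ln 2 = (x - \<theta> * x) * ln 2 - s * (x * ln 2 / c)" for x
      by (simp add: algebra_simps)
    have "?L / (\<theta> * ln 2) \<le> ?Q" using k0[OF k(1)] by linarith
    then have "?L \<le> \<theta> * ln 2 * ?Q" using \<theta> by (simp add: field_simps)
    also have "\<dots> = (1 - s / c - \<theta>) * ?Q * ln 2" by (simp add: \<theta>_def field_simps)
    also have "\<dots> = (?Q - \<theta> * ?Q) * ln 2 - s * (?Q * ln 2 / c)" by (rule distrib)
    also have "\<dots> \<le> real (card (block k)) * ln 2 - s * (?Q * ln 2 / c)"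
      unfolding card using Q by (intro diff_right_mono mult_right_mono) auto
    finally have "0 \<le> real (card (block k)) * ln 2 + s * ln (2 * \<eta> / 5)"
      unfolding ln\<eta> right_diff_distrib by linarith
    also have "\<dots> = ln (2 ^ card (block k) * (2 * \<eta> / 5) powr s)"
      using \<eta> by (subst ln_mult) (auto simp: ln_realpow ln_powr)
    finally show ?thesis using \<eta> by (subst (asm) ln_ge_zero_iff) auto
  qed
  then show ?thesis using le by (metis ennreal_1 ennreal_leI order_trans)
qed

lemma packing_dim_ge:
  assumes "point ` targeted_sequences \<subseteq> E"
  shows "ereal c \<le> packing_dim E"
  unfolding packing_dim_def
proof (rule INF_greatest)
  let ?K = "point ` targeted_sequences"
  fix s assume s: "s \<in> {s. 0 \<le> s \<and> packing_measure s E = 0}"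
  have "\<not> s < c"
  proof
    assume "s < c"
    have "1 \<le> packing_measure s E"
      unfolding packing_measure_def
    proof (rule INF_greatest)
      fix F :: "nat \<Rightarrow> 'a set" assume "F \<in> {F. E \<subseteq> (\<Union>i. F i)}"
      then have F: "?K \<subseteq> (\<Union>i. F i)" using assms by blast
      have "(\<lambda>_. False) \<in> targeted_sequences" by (simp add: targeted_sequences_def)
      then have "?K \<noteq> {}" by blast
      from Baire_countable_cover[OF compact_imp_closed[OF compact_targeted] this F]
      obtain i x \<epsilon> where "x \<in> ?K" "0 < \<epsilon>" "ball x \<epsilon> \<inter> ?K \<subseteq> closure (F i)" by blast
      then have "1 \<le> packing_sup s \<delta> (F i)" if "0 < \<delta>" for \<delta>
        using s \<open>s < c\<close> that by (intro packing_sup_ge[of s \<delta> x \<epsilon>]) auto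
      then have "1 \<le> packing_premeasure s (F i)"
        unfolding packing_premeasure_def by (intro INF_greatest) auto
      also have "\<dots> = (\<Sum>j\<in>{i}. packing_premeasure s (F j))" by simp
      also have "\<dots> \<le> (\<Sum>j. packing_premeasure s (F j))" by (rule sum_le_suminf) auto
      finally show "1 \<le> (\<Sum>i. packing_premeasure s (F i))" .
    qed
    then show False using s by simp
  qed
  then show "ereal c \<le> ereal s" by simp
qed

end

section \<open>The set with the three prescribed dimensions\<close>

lemma card_floor_density_set_bounds:
  assumes "0 \<le> \<alpha>" "\<alpha> \<le> 1"
  shows "\<alpha> * real n - 1 \<le> real (card (floor_density_set \<alpha> \<inter> {..<n}))"
    and "real (card (floor_density_set \<alpha> \<inter> {..<n})) \<le> \<alpha> * real n"
  using card_floor_density_set[OF assms, of n] by linarith+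

text \<open>
  Up to the end of block \<open>k\<close>, restriction to the blocks loses at most the positions below \<open>(2k)!\<close>.
\<close>

lemma card_floor_density_set_blocks_ge:
  assumes "0 \<le> \<beta>" "\<beta> \<le> 1"
  shows "(\<beta> - 1 / real (2 * k + 1) - 1 / real (fact (2 * k + 1))) * real (fact (2 * k + 1))
    \<le> real (card (floor_density_set \<beta> \<inter> (\<Union>k. block k) \<inter> {..<fact (2 * k + 1)}))"
proof -
  let ?D = "floor_density_set \<beta>" and ?q = "fact (2 * k) :: nat" and ?q' = "fact (2 * k + 1) :: nat"
  have "?D \<inter> {..<?q'} \<subseteq> {..<?q} \<union> (?D \<inter> (\<Union>k. block k) \<inter> {..<?q'})"
    by (auto simp: block_def not_less)
  then have "card (?D \<inter> {..<?q'}) \<le> card ({..<?q} \<union> (?D \<inter> (\<Union>k. block k) \<inter> {..<?q'}))"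
    by (intro card_mono) auto
  also have "\<dots> \<le> card {..<?q} + card (?D \<inter> (\<Union>k. block k) \<inter> {..<?q'})" by (rule card_Un_le)
  finally have "real (card (?D \<inter> {..<?q'})) \<le> real ?q + real (card (?D \<inter> (\<Union>k. block k) \<inter> {..<?q'}))"
    by (simp only: card_lessThan of_nat_add[symmetric] of_nat_le_iff)
  moreover have "\<beta> * real ?q' - 1 \<le> real (card (?D \<inter> {..<?q'}))"
    by (rule card_floor_density_set_bounds[OF assms])
  moreover have "real ?q = 1 / real (2 * k + 1) * real ?q'" by (rule fact_Suc_ratio)
  moreover have "1 / real ?q' * real ?q' = 1"
  proof -
    have "real ?q' \<noteq> 0" unfolding of_nat_eq_0_iff by (rule fact_nonzero)
    then show ?thesis by (simp only: times_divide_eq_left mult_1) (rule divide_self)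
  qed
  ultimately show ?thesis unfolding left_diff_distrib by linarith
qed

theorem proposition3p4:
  fixes a b c :: real
  assumes "0 < a" and "a < b" and "b < c" and "c < 1"
  shows "\<exists>E :: (real ^ 'n::finite) set.
           compact E \<and>
           modified_lower_box_dim E = ereal a \<and>
           upper_correlation_dim E = ereal b \<and>
           packing_dim E = ereal c"
proof -
  obtain e :: "real ^ 'n" where "norm e = 1" using vector_choose_size[of 1] by auto
  then interpret binary_cantor c e using assms by unfold_locales auto
  define \<alpha> \<beta> where "\<alpha> = a / c" and "\<beta> = b / c"
  have \<alpha>: "0 < \<alpha>" "\<alpha> \<le> 1" "c * \<alpha> = a" and \<beta>: "0 < \<beta>" "\<beta> \<le> 1" "c * \<beta> = b" and \<alpha>\<beta>: "\<alpha> \<le> \<beta>"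
    using assms by (auto simp: \<alpha>_def \<beta>_def field_simps)
  define D\<^sub>a where "D\<^sub>a = floor_density_set \<alpha>"
  define D\<^sub>b where "D\<^sub>b = floor_density_set \<beta> \<inter> (\<Union>k. block k)"
  have Da: "\<alpha> * real n - 1 \<le> real (card (D\<^sub>a \<inter> {..<n}))" "real (card (D\<^sub>a \<inter> {..<n})) \<le> \<alpha> * real n" for n
    unfolding D\<^sub>a_def by (rule card_floor_density_set_bounds, use \<alpha> in auto)+
  have Da': "real (card (D\<^sub>a \<inter> {..<n})) \<le> \<beta> * real n" for n
    using Da(2)[of n] mult_right_mono[OF \<alpha>\<beta>, of "real n"] by simp
  have Db: "real (card (D\<^sub>b \<inter> {..<n})) \<le> \<beta> * real n" for n
  proof -
    have "card (D\<^sub>b \<inter> {..<n}) \<le> card (floor_density_set \<beta> \<inter> {..<n})"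
      unfolding D\<^sub>b_def by (intro card_mono) auto
    then show ?thesis using card_floor_density_set_bounds(2)[of \<beta> n] \<beta> by linarith
  qed
  define E\<^sub>a E\<^sub>b E\<^sub>c where "E\<^sub>a = point ` sequences_in D\<^sub>a" and "E\<^sub>b = point ` sequences_in D\<^sub>b"
    and "E\<^sub>c = point ` targeted_sequences"
  define E where "E = E\<^sub>a \<union> E\<^sub>b \<union> E\<^sub>c"
  have cpt: "compact E\<^sub>a" "compact E\<^sub>b" "compact E\<^sub>c"
    unfolding E\<^sub>a_def E\<^sub>b_def E\<^sub>c_def by (rule compact_sequences_in compact_targeted)+
  then have compact: "compact E" unfolding E_def by (intro compact_Un)
  then have borel: "E \<in> sets borel" by (rule borel_compact)
  have ne: "E\<^sub>a \<noteq> {}" "E\<^sub>b \<noteq> {}" "E\<^sub>c \<noteq> {}"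
    unfolding E\<^sub>a_def E\<^sub>b_def E\<^sub>c_def sequences_in_def targeted_sequences_def by auto

  have "modified_lower_box_dim E = ereal a"
  proof (rule antisym)
    define F where "F i = (if i = 0 then E\<^sub>a else if i = 1 then E\<^sub>b else E\<^sub>c)" for i :: nat
    have dim_a: "lower_box_dim E\<^sub>a \<le> ereal a"
      unfolding E\<^sub>a_def \<alpha>(3)[symmetric] by (rule lower_box_dim_sequences_in_le) (rule Da(2))
    have dim_b: "lower_box_dim E\<^sub>b \<le> 0"
      unfolding E\<^sub>b_def by (rule lower_box_dim_blocks_le) (auto simp: sequences_in_def D\<^sub>b_def)
    have dim_c: "lower_box_dim E\<^sub>c \<le> 0"
      unfolding E\<^sub>c_def by (rule lower_box_dim_blocks_le) (auto simp: targeted_sequences_def)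
    have "(SUP i. lower_box_dim (F i)) \<le> ereal a"
    proof (rule SUP_least)
      have "0 \<le> ereal a" using assms by simp
      then show "lower_box_dim (F i) \<le> ereal a" for i
        unfolding F_def using dim_a dim_b dim_c by (auto intro: order_trans)
    qed
    moreover have "(\<forall>i. F i \<noteq> {} \<and> compact (F i)) \<and> E \<subseteq> (\<Union>i. F i)"
    proof -
      have "E \<subseteq> F 0 \<union> F 1 \<union> F 2" by (simp add: F_def E_def)
      then show ?thesis using ne cpt by (auto simp: F_def)
    qed
    ultimately show "modified_lower_box_dim E \<le> ereal a"
      unfolding modified_lower_box_dim_def by (intro INF_lower2[of F]) auto
    show "ereal a \<le> modified_lower_box_dim E"
      unfolding \<alpha>(3)[symmetric]
      by (rule modified_lower_box_dim_ge[OF borel _ Da(1)]) (auto simp: E_def E\<^sub>a_def)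
  qed

  moreover have "upper_correlation_dim E = ereal b"
  proof (rule antisym)
    show "upper_correlation_dim E \<le> ereal b"
      unfolding upper_correlation_dim_def
    proof (rule SUP_least)
      fix \<mu> assume "\<mu> \<in> borel_prob_measures_on E"
      then have \<mu>: "prob_space \<mu>" "sets \<mu> = sets borel" "emeasure \<mu> (UNIV - E) = 0"
        by (auto simp: borel_prob_measures_on_def)
      interpret prob_space \<mu> by fact
      have sp: "space \<mu> = UNIV" using sets_eq_imp_space_eq[OF \<mu>(2)] by simp
      have sets: "E\<^sub>a \<in> sets \<mu>" "E\<^sub>b \<in> sets \<mu>" "E\<^sub>c \<in> sets \<mu>" "E \<in> sets \<mu>"
        using cpt compact \<mu>(2) by (simp_all add: borel_compact)
      have "measure \<mu> (UNIV - E) = 0" using \<mu>(3) by (simp add: measure_def)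
      then have "measure \<mu> E = 1" using prob_compl[of E] sets sp by simp
      moreover have "measure \<mu> E \<le> measure \<mu> E\<^sub>a + measure \<mu> E\<^sub>b + measure \<mu> E\<^sub>c"
        unfolding E_def using sets measure_Un_le[of "E\<^sub>a \<union> E\<^sub>b" \<mu> E\<^sub>c] measure_Un_le[of E\<^sub>a \<mu> E\<^sub>b] by auto
      ultimately consider "0 < measure \<mu> E\<^sub>a" | "0 < measure \<mu> E\<^sub>b" | "0 < measure \<mu> E\<^sub>c"
        by linarith
      then show "upper_correlation_dim_measure \<mu> \<le> ereal b"
      proof cases
        case 1
        then show ?thesis
          using correlation_dim_sequences_in_le[OF \<mu>(1,2) _ Da'] \<beta>(3) by (simp add: E\<^sub>a_def)
      next
        case 2
        then show ?thesis
          using correlation_dim_sequences_in_le[OF \<mu>(1,2) _ Db] \<beta>(3) by (simp add: E\<^sub>b_def)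
      next
        case 3
        then show ?thesis
          using correlation_dim_targeted_le[OF \<mu>(1,2) _ \<beta>(1)] \<beta>(3) by (simp add: E\<^sub>c_def)
      qed
    qed
    have "coin_measure D\<^sub>b \<in> borel_prob_measures_on E"
      by (rule coin_measure_in_borel_prob_measures_on[OF borel])
        (auto simp: E_def E\<^sub>b_def sequences_in_def)
    then have "upper_correlation_dim_measure (coin_measure D\<^sub>b) \<le> upper_correlation_dim E"
      unfolding upper_correlation_dim_def by (rule SUP_upper)
    moreover have "ereal (c * \<beta>) \<le> upper_correlation_dim_measure (coin_measure D\<^sub>b)"
    proof (rule upper_correlation_dim_coin_measure_ge)
      show fl: "filterlim (\<lambda>k. fact (2 * k + 1) :: nat) at_top sequentially"
        by (rule filterlim_fact) (simp add: strict_mono_def)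
      show "eventually (\<lambda>k. (\<beta> - 1 / real (2 * k + 1) - 1 / real (fact (2 * k + 1))) * real (fact (2 * k + 1))
          \<le> real (card (D\<^sub>b \<inter> {..<fact (2 * k + 1)}))) sequentially"
        unfolding D\<^sub>b_def by (intro always_eventually allI card_floor_density_set_blocks_ge) (use \<beta> in auto)
      have "(\<lambda>k. 1 / real (2 * k + 1)) \<longlonglongrightarrow> 0"
        by (rule filterlim_compose[OF lim_1_over_n]) (rule filterlim_subseq, simp add: strict_mono_def)
      moreover have "(\<lambda>k. 1 / real (fact (2 * k + 1))) \<longlonglongrightarrow> 0"
        by (rule filterlim_compose[OF lim_1_over_n fl])
      ultimately have "(\<lambda>k. \<beta> - 1 / real (2 * k + 1) - 1 / real (fact (2 * k + 1))) \<longlonglongrightarrow> \<beta> - 0 - 0"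
        by (intro tendsto_intros)
      then show "(\<lambda>k. \<beta> - 1 / real (2 * k + 1) - 1 / real (fact (2 * k + 1))) \<longlonglongrightarrow> \<beta>" by simp
    qed
    ultimately have "ereal (c * \<beta>) \<le> upper_correlation_dim E" by (rule order_trans[rotated])
    then show "ereal b \<le> upper_correlation_dim E" using \<beta>(3) by simp
  qed

  moreover have "packing_dim E = ereal c"
  proof (rule antisym)
    show "packing_dim E \<le> ereal c" by (rule packing_dim_le) (auto simp: E_def E\<^sub>a_def E\<^sub>b_def E\<^sub>c_def)
    show "ereal c \<le> packing_dim E" by (rule packing_dim_ge) (auto simp: E_def E\<^sub>c_def)
  qed

  ultimately show ?thesis using compact by blast
qed

end
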